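(* Suppose $\mathbb{P}(B>x)=L(x)x^{-\alpha}$ for some $\alpha>2$ and $L$ slowly varying. Fix $y>0$. Then for $y_\rho^*=\frac{y}{(1-\rho)^2}$ the limit diverges to infinity: $$\lim_{\rho\uparrow 1}\frac{\mathbb{P}(\tau>y_\rho^* )}{\frac{\rho}{1-\rho}\mathbb{P}(B>(1-\rho)y_\rho^* )}=\infty.$$
   Context: Let $B,B_0,B_1,B_2,\ldots$ be i.i.d. non-negative random variables with $\mathbb{P}(B\le 0)=0$, mean $\mathbb{E}[B]>0$ and finite variance. A function $L$ is slowly varying if $\lim_{x\to\infty}L(ax)/L(x)=1$ for all $a>0$. Let $N^1(t)$, $t\ge 0$, be a Poisson process with rate $1/\mathbb{E}[B]$, independent of the $B_i$; for $\rho\in(0,1)$ let $N^\rho(t):=N^1(\rho t)$, a Poisson process with rate $\rho/\mathbb{E}[B]$. Define $X(t)=X^\rho(t):=X_0+\sum_{i=1}^{N^\rho(t)}B_i-t$ for $t\ge 0$, with $X_0:=B_0$. Let $\tau=\tau^\rho:=\inf\{t\ge 0:X^\rho(t)=0\}$ be the first hitting time of zero. The distribution of $B$ does not depend on $\rho$. *)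

theory Defs
  imports "HOL-Probability.Probability"
begin

definition slowly_varying :: "(real \<Rightarrow> real) \<Rightarrow> bool" where
  "slowly_varying L \<longleftrightarrow> (\<forall>a>0. ((\<lambda>x. L (a * x) / L x) \<longlongrightarrow> 1) at_top)"

text \<open>The time parameter ranges over the nonnegative reals; values at negative times are
  unconstrained. The path properties (start at zero, monotone, right-continuous) hold on the
  whole sample space. Monotonicity makes the truncated subtraction on \<^typ>\<open>nat\<close> in the
  increments the true difference.\<close>

definition poisson_process :: "'a measure \<Rightarrow> real \<Rightarrow> (real \<Rightarrow> 'a \<Rightarrow> nat) \<Rightarrow> bool" where
  "poisson_process M r N \<longleftrightarrow>
     0 < r \<and>
     (\<forall>t\<ge>0. N t \<in> measurable M (count_space UNIV)) \<and>
     (\<forall>\<omega>\<in>space M. N 0 \<omega> = 0) \<and>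
     (\<forall>\<omega>\<in>space M. mono_on {0..} (\<lambda>t. N t \<omega>)) \<and>
     (\<forall>\<omega>\<in>space M. \<forall>t\<ge>0. continuous (at_right t) (\<lambda>s. real (N s \<omega>))) \<and>
     (\<forall>s t. 0 \<le> s \<and> s < t \<longrightarrow>
        distr M (count_space UNIV) (\<lambda>\<omega>. N t \<omega> - N s \<omega>)
          = measure_pmf (poisson_pmf (r * (t - s)))) \<and>
     (\<forall>(n::nat) (t :: nat \<Rightarrow> real). 0 \<le> t 0 \<and> (\<forall>i<n. t i \<le> t (Suc i)) \<longrightarrow>
        prob_space.indep_vars M (\<lambda>_. count_space UNIV)
          (\<lambda>i \<omega>. N (t (Suc i)) \<omega> - N (t i) \<omega>) {..<n})"

text \<open>Independence of the whole process from the whole sequence, as independence of the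
  sigma-algebras they generate; the library's \<open>indep_var\<close> needs both variables to have the
  same value type.\<close>

definition process_indep_of_seq ::
    "'a measure \<Rightarrow> (real \<Rightarrow> 'a \<Rightarrow> nat) \<Rightarrow> (nat \<Rightarrow> 'a \<Rightarrow> real) \<Rightarrow> bool" where
  "process_indep_of_seq M N Bs \<longleftrightarrow>
     prob_space.indep_set M
       (sets (vimage_algebra (space M) (\<lambda>\<omega>. \<lambda>t\<in>{0..}. N t \<omega>)
                (\<Pi>\<^sub>M t\<in>{0..}. count_space UNIV)))
       (sets (vimage_algebra (space M) (\<lambda>\<omega> i. Bs i \<omega>) (\<Pi>\<^sub>M i\<in>UNIV. borel)))"

text \<open>Here \<open>N\<close> is the process of rate \<open>1 / E[B]\<close>; the arrival process at load \<open>\<rho>\<close> is the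
  time change \<open>N (\<rho> * t)\<close>.\<close>

definition workload ::
    "(nat \<Rightarrow> 'a \<Rightarrow> real) \<Rightarrow> (real \<Rightarrow> 'a \<Rightarrow> nat) \<Rightarrow> real \<Rightarrow> real \<Rightarrow> 'a \<Rightarrow> real" where
  "workload Bs N \<rho> t \<omega> = Bs 0 \<omega> + (\<Sum>i=1..N (\<rho> * t) \<omega>. Bs i \<omega>) - t"

text \<open>Extended-real valued, so that the hitting time is \<open>\<infinity>\<close> if zero is never hit.\<close>

definition hitting_time ::
    "(nat \<Rightarrow> 'a \<Rightarrow> real) \<Rightarrow> (real \<Rightarrow> 'a \<Rightarrow> nat) \<Rightarrow> real \<Rightarrow> 'a \<Rightarrow> ereal" where
  "hitting_time Bs N \<rho> \<omega> = Inf (ereal ` {t. 0 \<le> t \<and> workload Bs N \<rho> t \<omega> = 0})"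

end

theory Submission
  imports Defs
begin

text \<open>
  The claim follows from comparing numerator and denominator with \<open>1 - \<rho>\<close>. A finite second moment
  gives \<open>x\<^sup>2 P(B > x) \<longlonglongrightarrow> 0\<close> (\<open>second_moment_tail\<close>), so \<open>P(B > y / (1 - \<rho>))\<close> is of smaller order
  than \<open>(1 - \<rho>)\<^sup>2\<close> and the denominator is of smaller order than \<open>1 - \<rho>\<close>; slow
  variation makes \<open>L\<close> eventually nonzero, so that the denominator is positive. The
  numerator, on the other hand, is at least \<open>c (1 - \<rho>)\<close> (\<open>prob_hitting_time_ge\<close>): a walk that is
  critical up to a drift of size \<open>1 - \<rho>\<close> survives for a time of order \<open>1 / (1 - \<rho>)\<^sup>2\<close> with
  probability of order \<open>1 - \<rho>\<close>, just as a critical walk survives \<open>n\<close> steps with probability of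
  order \<open>1 / sqrt n\<close>.

  The dependence on \<open>\<rho>\<close> is isolated by running time at speed \<open>\<rho>\<close>. At time \<open>s / \<rho>\<close> the workload is
  \<open>B\<^sub>0 + (A s - s) - e s\<close> with \<open>e = 1 / \<rho> - 1\<close>, where \<open>A s\<close> sums the service times of the arrivals of the
  rate \<open>1 / E[B]\<close> process up to \<open>s\<close> and has nothing to do with \<open>\<rho>\<close>. Sampled at integer times,
  \<open>W\<^sub>k = A k - k\<close> is one fixed random walk with centred, square integrable, independent and
  identically distributed steps (\<open>centered_batch_walk\<close>). Since \<open>A\<close> is nondecreasing, the workload stays
  positive as soon as \<open>B\<^sub>0 > 2\<close> and \<open>W\<^sub>k > e k\<close> for all integers \<open>k\<close> in the time window
  (\<open>workload_pos\<close>). So everything rests on one statement about such walks, \<open>prob_above_line_ge\<close>: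
  \<open>P(W\<^sub>k > e k for 1 \<le> k \<le> Y / e\<^sup>2) \<ge> c e\<close> for all small \<open>e\<close>.

  The walk estimate has three ingredients. First, the Lindley recursion \<open>Z\<^sub>k\<^sub>+\<^sub>1 = max 0 (Z\<^sub>k - \<xi>\<^sub>k)\<close> has
  \<open>E[Z\<^sub>n\<^sup>2] \<le> \<sigma>\<^sup>2 n\<close>, while \<open>Z\<^sub>n + W\<^sub>n\<close> gains at least \<open>max 0 \<xi>\<^sub>k\<close> whenever \<open>Z\<^sub>k = 0\<close>. Comparing
  expectations bounds \<open>\<Sum>k<n. P(Z\<^sub>k = 0)\<close> by a multiple of \<open>sqrt n\<close>, and by time reversal this sum
  dominates \<open>\<Sum>k<n. P(W\<^sub>1, \<dots>, W\<^sub>k > 0)\<close>. Second, this upper bound turns into a lower bound through the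
  first two moments of \<open>W\<^sub>n - e n\<close> restricted to survival: as long as \<open>e sqrt n\<close> is small, the first
  stays bounded below, the second is of order \<open>sqrt n\<close>, and a Cauchy-Schwarz argument shows that with
  probability at least \<open>c / sqrt n\<close> the walk survives \<open>n\<close> steps and ends at height of order \<open>sqrt n\<close>
  (\<open>prob_alive_high\<close>). Third, such a height protects the walk during a further block of steps
  of comparable length, on which it does not dip too far and does not end lower with probability
  bounded below, by the central limit theorem. A bounded number of independent blocks reaches the
  horizon \<open>Y / e\<^sup>2\<close>.
\<close>

section \<open>Expectations of truncated variables\<close>

lemma measurable_of_bool_real [measurable]:
  "Measurable.pred M P \<Longrightarrow> (\<lambda>\<omega>. of_bool (P \<omega>) :: real) \<in> borel_measurable M"
  unfolding of_bool_def by measurable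

lemma (in prob_space) expectation_of_bool:
  assumes [measurable]: "Measurable.pred M P"
  shows "integrable M (\<lambda>\<omega>. of_bool (P \<omega>) :: real)"
    and "expectation (\<lambda>\<omega>. of_bool (P \<omega>) :: real) = prob {\<omega>\<in>space M. P \<omega>}"
proof -
  have "expectation (\<lambda>\<omega>. of_bool (P \<omega>) :: real)
    = expectation (indicator {\<omega>\<in>space M. P \<omega>})"
    by (rule Bochner_Integration.integral_cong) (auto simp: indicator_def)
  then show "expectation (\<lambda>\<omega>. of_bool (P \<omega>) :: real) = prob {\<omega>\<in>space M. P \<omega>}"
    by simp
  show "integrable M (\<lambda>\<omega>. of_bool (P \<omega>) :: real)"
    by (rule integrable_const_bound[of _ 1]) auto
qed

lemma (in prob_space) integrable_mult_of_bool:
  fixes f :: "'a \<Rightarrow> real"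
  assumes [measurable]: "integrable M f" "Measurable.pred M P"
  shows "integrable M (\<lambda>\<omega>. f \<omega> * of_bool (P \<omega>))"
  by (rule Bochner_Integration.integrable_bound[OF assms(1)]) auto

lemma (in prob_space) expectation_le_sqrt_second_moment:
  assumes "integrable M X" "integrable M (\<lambda>\<omega>. (X \<omega>)\<^sup>2)" "expectation (\<lambda>\<omega>. (X \<omega>)\<^sup>2) \<le> c"
  shows "expectation X \<le> sqrt c"
proof -
  have "(expectation X)\<^sup>2 \<le> expectation (\<lambda>\<omega>. (X \<omega>)\<^sup>2)"
    using variance_eq[OF assms(1,2)] variance_positive[of X] by linarith
  then show ?thesis
    using assms(3) real_le_rsqrt by (meson order_trans)
qed

section \<open>Sequences of independent and identically distributed variables\<close>

locale indep_sequence = prob_space M for M :: "'a measure" +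
  fixes X :: "nat \<Rightarrow> 'a \<Rightarrow> real"
  assumes indep: "indep_vars (\<lambda>_. borel) X UNIV"
begin

lemma measurable_X [measurable]: "X i \<in> borel_measurable M"
  using indep by (auto simp: indep_vars_def)

text \<open>The \<open>\<sigma>\<close>-algebra generated by the variables with index in \<open>I\<close>. Writing "depends only on these
  variables" as measurability with respect to it lets independence be used without factorising
  functions through the product space.\<close>
definition info :: "nat set \<Rightarrow> 'a measure" where
  "info I = vimage_algebra (space M) (\<lambda>\<omega>. \<lambda>i\<in>I. X i \<omega>) (\<Pi>\<^sub>M i\<in>I. borel)"

lemma space_info [simp]: "space (info I) = space M"
  by (simp add: info_def)

lemma X_info: "i \<in> I \<Longrightarrow> X i \<in> borel_measurable (info I)"
proof -
  assume i: "i \<in> I"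
  have "(\<lambda>\<omega>. \<lambda>i\<in>I. X i \<omega>) \<in> measurable (info I) (\<Pi>\<^sub>M i\<in>I. borel)"
    unfolding info_def by (rule measurable_vimage_algebra1) (auto simp: space_PiM)
  from measurable_compose[OF this measurable_component_singleton[OF i]] i
  show ?thesis by simp
qed

lemma X_info_single: "X i \<in> borel_measurable (info {i})"
  by (rule X_info) simp

lemma sets_info_subset: 
  assumes N: "space N = space M" and "\<And>i. i \<in> I \<Longrightarrow> X i \<in> borel_measurable N" 
  shows "sets (info I) \<subseteq> sets N"
  unfolding info_def
  by (rule sets_image_in_sets[OF N]) (use assms(2) in \<open>auto intro!: measurable_restrict\<close>)

lemma measurable_info_imp:
  assumes "f \<in> measurable (info I) N"
  shows "f \<in> measurable M N"
proof -
  have "sets (info I) \<subseteq> sets M" by (rule sets_info_subset) auto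
  then show ?thesis using assms unfolding measurable_def by auto
qed

text \<open>The preimages under \<open>f\<close> and \<open>g\<close> lie in the \<open>\<sigma>\<close>-algebras of two disjoint groups of variables, so
  their independence is inherited from that of the groups.\<close>
lemma indep_info:
  assumes IJ: "I \<inter> J = {}" and f: "f \<in> borel_measurable (info I)" and g: "g \<in> borel_measurable (info J)"
  shows "indep_var borel f borel g"
proof -
  have vim: "sigma_sets (space M) {f -` A \<inter> space M |A. A \<in> sets borel} \<subseteq> sets (info I)"
    if "f \<in> borel_measurable (info I)" for f I
    using sets.sigma_sets_subset[of "{f -` A \<inter> space M |A. A \<in> sets borel}" "info I"]
      measurable_sets[OF that] by auto
  have "indep_set (sets (info I)) (sets (info J))"
    using indep_var_restrict[OF indep IJ] unfolding indep_var_eq info_def sets_vimage_algebra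
    by simp
  then have "indep_set (sigma_sets (space M) {f -` A \<inter> space M |A. A \<in> sets borel})
     (sigma_sets (space M) {g -` A \<inter> space M |A. A \<in> sets borel})"
    using vim[OF f] vim[OF g] unfolding indep_sets2_eq by blast
  then show ?thesis
    unfolding indep_var_eq using f g measurable_info_imp by blast
qed

lemma expectation_mult_info:
  assumes "I \<inter> J = {}" "f \<in> borel_measurable (info I)" "g \<in> borel_measurable (info J)"
    "integrable M f" "integrable M g"
  shows "integrable M (\<lambda>\<omega>. f \<omega> * g \<omega> :: real)"
    and "expectation (\<lambda>\<omega>. f \<omega> * g \<omega>) = expectation f * expectation g"
  using indep_var_integrable indep_var_lebesgue_integral indep_info[OF assms(1-3)] assms(4,5)
  by blast+

lemma prob_conj_info:
  assumes "I \<inter> J = {}" and P: "Measurable.pred (info I) P" and Q: "Measurable.pred (info J) Q"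
  shows "prob {\<omega>\<in>space M. P \<omega> \<and> Q \<omega>} = prob {\<omega>\<in>space M. P \<omega>} * prob {\<omega>\<in>space M. Q \<omega>}"
proof -
  note [measurable] = measurable_info_imp[OF P] measurable_info_imp[OF Q]
  have "expectation (\<lambda>\<omega>. of_bool (P \<omega>) * of_bool (Q \<omega>) :: real)
      = expectation (\<lambda>\<omega>. of_bool (P \<omega>)) * expectation (\<lambda>\<omega>. of_bool (Q \<omega>))"
    by (rule expectation_mult_info(2)[OF assms(1)])
       (use P Q in \<open>auto intro!: measurable_of_bool_real expectation_of_bool(1)\<close>)
  then show ?thesis
    by (simp add: expectation_of_bool flip: of_bool_conj)
qed

end

locale iid_sequence = indep_sequence M X for M :: "'a measure" and X +
  assumes ident: "\<And>i. distr M borel (X i) = distr M borel (X 0)"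
begin

lemma moment_ident:
  assumes [measurable]: "f \<in> borel_measurable (borel :: real measure)"
  shows "expectation (\<lambda>\<omega>. f (X i \<omega>) :: real) = expectation (\<lambda>\<omega>. f (X 0 \<omega>))"
    and "integrable M (\<lambda>\<omega>. f (X i \<omega>) :: real) \<longleftrightarrow> integrable M (\<lambda>\<omega>. f (X 0 \<omega>))"
proof -
  show "expectation (\<lambda>\<omega>. f (X i \<omega>) :: real) = expectation (\<lambda>\<omega>. f (X 0 \<omega>))"
    using integral_distr[of "X i" M borel f] integral_distr[of "X 0" M borel f] ident[of i]
    by simp
  show "integrable M (\<lambda>\<omega>. f (X i \<omega>) :: real) \<longleftrightarrow> integrable M (\<lambda>\<omega>. f (X 0 \<omega>))"
    using integrable_distr_eq[of "X i" M borel f] integrable_distr_eq[of "X 0" M borel f] ident[of i]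
    by simp
qed

text \<open>Both families have the same joint law, namely the product of the common marginal. This one
  symmetry yields reversal and shift of walks as well as the fact that a sum over an index set
  depends in law only on the cardinality of the set.\<close>
lemma prob_relabel:
  assumes inj: "inj_on \<pi> I" and A: "A \<in> sets (\<Pi>\<^sub>M i\<in>I. borel)"
  shows "prob {\<omega>\<in>space M. (\<lambda>i\<in>I. X (\<pi> i) \<omega>) \<in> A} = prob {\<omega>\<in>space M. (\<lambda>i\<in>I. X i \<omega>) \<in> A}"
proof (cases "I = {}")
  case True
  then show ?thesis by (simp add: restrict_def)
next
  case ne: False
  let ?P = "\<Pi>\<^sub>M i\<in>I. (borel :: real measure)"
  have ind: "indep_vars (\<lambda>_. borel) (\<lambda>i. X (\<pi> i)) I"
  proof -
    have "indep_vars (\<lambda>j. PiM {\<pi> j} (\<lambda>_. borel)) (\<lambda>j \<omega>. \<lambda>i\<in>{\<pi> j}. X i \<omega>) I"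
      by (rule indep_vars_restrict[OF indep])
         (use inj in \<open>auto simp: disjoint_family_on_def inj_on_def\<close>)
    then have "indep_vars (\<lambda>_. borel) (\<lambda>j \<omega>. (\<lambda>x. x (\<pi> j)) (\<lambda>i\<in>{\<pi> j}. X i \<omega>)) I"
      by (rule indep_vars_compose2) auto
    then show ?thesis by simp
  qed
  have "distr M ?P (\<lambda>\<omega>. \<lambda>i\<in>I. X (\<pi> i) \<omega>) = (\<Pi>\<^sub>M i\<in>I. distr M borel (X (\<pi> i)))"
    using ind by (subst (asm) indep_vars_iff_distr_eq_PiM[OF ne]) auto
  also have "\<dots> = (\<Pi>\<^sub>M i\<in>I. distr M borel (X i))"
    using ident by (intro PiM_cong) metis+
  also have "\<dots> = distr M ?P (\<lambda>\<omega>. \<lambda>i\<in>I. X i \<omega>)"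
    using indep_vars_subset[OF indep subset_UNIV, of I]
    by (subst (asm) indep_vars_iff_distr_eq_PiM[OF ne]) auto
  finally have "measure (distr M ?P (\<lambda>\<omega>. \<lambda>i\<in>I. X (\<pi> i) \<omega>)) A
      = measure (distr M ?P (\<lambda>\<omega>. \<lambda>i\<in>I. X i \<omega>)) A" by simp
  moreover have "measure (distr M ?P (\<lambda>\<omega>. \<lambda>i\<in>I. X (p i) \<omega>)) A
     = prob {\<omega>\<in>space M. (\<lambda>i\<in>I. X (p i) \<omega>) \<in> A}" for p
    by (subst measure_distr) (use A in \<open>auto intro!: arg_cong[of _ _ prob]\<close>)
  ultimately show ?thesis by simp
qed

text \<open>The sets \<open>S j\<close> may depend on the time \<open>j\<close>, so that constraints on the whole path and on its end point
  are covered at once.\<close>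
lemma prob_partial_sums_relabel:
  assumes inj: "inj_on \<pi> {..<k}" and S: "\<And>j. S j \<in> sets borel"
  shows "prob {\<omega>\<in>space M. \<forall>j\<le>k. (\<Sum>i<j. X (\<pi> i) \<omega>) \<in> S j} = prob {\<omega>\<in>space M. \<forall>j\<le>k. (\<Sum>i<j. X i \<omega>) \<in> S j}"
proof -
  let ?P = "\<Pi>\<^sub>M i\<in>{..<k}. (borel :: real measure)"
  define A where "A = {x \<in> space ?P. \<forall>j\<in>{..k}. (\<Sum>i<j. x i) \<in> S j}"
  have sum_meas: "(\<lambda>x. \<Sum>i<j. x i) \<in> borel_measurable ?P" if "j \<in> {..k}" for j
    using that by (intro borel_measurable_sum) (auto intro!: measurable_component_singleton)
  have A: "A \<in> sets ?P"
    unfolding A_def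
    by (intro sets.sets_Collect_finite_All' measurable_sets_Collect[OF sum_meas]) (use S in auto)
  have "(\<lambda>i\<in>{..<k}. X (p i) \<omega>) \<in> A \<longleftrightarrow> (\<forall>j\<le>k. (\<Sum>i<j. X (p i) \<omega>) \<in> S j)" for p \<omega>
    by (auto simp: A_def space_PiM)
  then show ?thesis using prob_relabel[OF inj A] by simp
qed

lemma prob_sum_card:
  assumes "finite S" and A: "A \<in> sets borel"
  shows "prob {\<omega>\<in>space M. (\<Sum>i\<in>S. X i \<omega>) \<in> A} = prob {\<omega>\<in>space M. (\<Sum>i<card S. X i \<omega>) \<in> A}"
proof -
  obtain \<pi> where \<pi>: "bij_betw \<pi> {0..<card S} S"
    using ex_bij_betw_nat_finite[OF assms(1)] by blast
  define T where "T j = (if j = card S then A else UNIV)" for j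
  have T: "T j \<in> sets borel" for j using A by (simp add: T_def)
  have inj: "inj_on \<pi> {..<card S}" using \<pi> by (simp add: bij_betw_def lessThan_atLeast0)
  have "(\<Sum>i<card S. X (\<pi> i) \<omega>) = (\<Sum>i\<in>S. X i \<omega>)" for \<omega>
    using sum.reindex_bij_betw[OF \<pi>, of "\<lambda>i. X i \<omega>"] by (simp add: lessThan_atLeast0)
  moreover have "(\<forall>j\<le>card S. f j \<in> T j) \<longleftrightarrow> f (card S) \<in> A" for f
    by (auto simp: T_def)
  ultimately show ?thesis using prob_partial_sums_relabel[of \<pi> "card S" T, OF inj T] by simp
qed

end

section \<open>The reflected walk\<close>

locale centered_walk = iid_sequence M \<xi> for M :: "'a measure" and \<xi> +
  fixes \<sigma> :: real
  assumes step0_sq: "integrable M (\<lambda>\<omega>. (\<xi> 0 \<omega>)\<^sup>2)"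
    and step0_mean: "expectation (\<xi> 0) = 0"
    and \<sigma>_pos: "0 < \<sigma>"
    and step0_second: "expectation (\<lambda>\<omega>. (\<xi> 0 \<omega>)\<^sup>2) = \<sigma>\<^sup>2"
begin

lemma step_moments:
  shows "integrable M (\<lambda>\<omega>. (\<xi> i \<omega>)\<^sup>2)" "expectation (\<lambda>\<omega>. (\<xi> i \<omega>)\<^sup>2) = \<sigma>\<^sup>2"
    "integrable M (\<xi> i)" "expectation (\<xi> i) = 0"
proof -
  show sq: "integrable M (\<lambda>\<omega>. (\<xi> i \<omega>)\<^sup>2)"
    using step0_sq moment_ident(2)[of "\<lambda>x. x\<^sup>2" i] by simp
  show "expectation (\<lambda>\<omega>. (\<xi> i \<omega>)\<^sup>2) = \<sigma>\<^sup>2"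
    using step0_second moment_ident(1)[of "\<lambda>x. x\<^sup>2" i] by simp
  show "integrable M (\<xi> i)"
    using square_integrable_imp_integrable[OF _ sq] by simp
  show "expectation (\<xi> i) = 0"
    using step0_mean moment_ident(1)[of "\<lambda>x. x" i] by simp
qed

definition W :: "nat \<Rightarrow> 'a \<Rightarrow> real" where
  "W k \<omega> = (\<Sum>i<k. \<xi> i \<omega>)"

lemma W_0 [simp]: "W 0 \<omega> = 0"
  and W_Suc: "W (Suc k) \<omega> = W k \<omega> + \<xi> k \<omega>"
  by (simp_all add: W_def)

lemma W_info: "k \<le> n \<Longrightarrow> W k \<in> borel_measurable (info {..<n})"
  unfolding W_def[abs_def] by (intro borel_measurable_sum X_info) auto

lemma measurable_W [measurable]: "W k \<in> borel_measurable M"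
  unfolding W_def[abs_def] by measurable

lemma prob_walk_reversed:
  assumes S: "\<And>j. S j \<in> sets borel"
  shows "prob {\<omega>\<in>space M. \<forall>j\<le>k. W k \<omega> - W (k - j) \<omega> \<in> S j} = prob {\<omega>\<in>space M. \<forall>j\<le>k. W j \<omega> \<in> S j}"
proof -
  have sum: "(\<Sum>i<j. \<xi> (k - Suc i) \<omega>) = W k \<omega> - W (k - j) \<omega>" if "j \<le> k" for j \<omega>
    using that
  proof (induction j)
    case (Suc j)
    then have "k - j = Suc (k - Suc j)" by simp
    then have "W (k - j) \<omega> = W (k - Suc j) \<omega> + \<xi> (k - Suc j) \<omega>" by (metis W_Suc)
    then show ?case using Suc by simp
  qed simp
  have "inj_on (\<lambda>i. k - Suc i) {..<k}" by (auto simp: inj_on_def)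
  from prob_partial_sums_relabel[of _ k S, OF this S, folded W_def] show ?thesis
    by (simp add: sum cong: conj_cong)
qed

lemma prob_walk_shifted:
  assumes S: "\<And>j. S j \<in> sets borel"
  shows "prob {\<omega>\<in>space M. \<forall>j\<le>k. W (n + j) \<omega> - W n \<omega> \<in> S j} = prob {\<omega>\<in>space M. \<forall>j\<le>k. W j \<omega> \<in> S j}"
proof -
  have sum: "(\<Sum>i<j. \<xi> (n + i) \<omega>) = W (n + j) \<omega> - W n \<omega>" for j \<omega>
    by (induction j) (auto simp: W_Suc)
  have "inj_on (\<lambda>i. n + i) {..<k}" by (auto simp: inj_on_def)
  from prob_partial_sums_relabel[of _ k S, OF this S, folded W_def] show ?thesis
    by (simp add: sum)
qed

text \<open>The mean of the positive part of a step measures how far the walk is from being degenerate.\<close>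
definition \<kappa> :: real where
  "\<kappa> = expectation (\<lambda>\<omega>. max 0 (\<xi> 0 \<omega>))"

lemma integrable_pos_part: "integrable M (\<lambda>\<omega>. max 0 (\<xi> i \<omega>))"
  using step_moments(3)[of i] by (intro integrable_max) auto

lemma expectation_pos_part: "expectation (\<lambda>\<omega>. max 0 (\<xi> i \<omega>)) = \<kappa>"
  using moment_ident(1)[of "max 0" i] unfolding \<kappa>_def by simp

lemma \<kappa>_pos: "0 < \<kappa>"
proof (rule ccontr)
  assume "\<not> 0 < \<kappa>"
  moreover have "0 \<le> \<kappa>" unfolding \<kappa>_def by (rule Bochner_Integration.integral_nonneg) auto
  ultimately have "expectation (\<lambda>\<omega>. max 0 (\<xi> 0 \<omega>)) = 0"
    unfolding \<kappa>_def by linarith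
  then have "AE \<omega> in M. max 0 (\<xi> 0 \<omega>) = 0"
    using integral_nonneg_eq_0_iff_AE[OF integrable_pos_part[of 0]] by auto
  then have le: "AE \<omega> in M. 0 \<le> - \<xi> 0 \<omega>" by eventually_elim (auto simp: max_def split: if_splits)
  have "AE \<omega> in M. - \<xi> 0 \<omega> = 0"
    using integral_nonneg_eq_0_iff_AE[OF _ le] step_moments(3,4)[of 0] by simp
  then have "expectation (\<lambda>\<omega>. (\<xi> 0 \<omega>)\<^sup>2) = expectation (\<lambda>\<omega>. 0)"
    by (intro integral_cong_AE) auto
  then show False using step0_second \<sigma>_pos by simp
qed

text \<open>This is the distance of the walk below its running maximum, that is \<open>max\<^sub>j\<^sub>\<le>\<^sub>k W\<^sub>j - W\<^sub>k\<close>
  (\<open>gap_ge\<close> and \<open>gap_attained\<close>), in the form of the Lindley recursion, which makes its second moment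
  easy to control.\<close>
primrec gap :: "nat \<Rightarrow> 'a \<Rightarrow> real" where
  "gap 0 = (\<lambda>_. 0)"
| "gap (Suc k) = (\<lambda>\<omega>. max 0 (gap k \<omega> - \<xi> k \<omega>))"

lemma gap_nonneg: "0 \<le> gap k \<omega>"
  by (cases k) auto

lemma gap_info: "k \<le> n \<Longrightarrow> gap k \<in> borel_measurable (info {..<n})"
proof (induction k)
  case (Suc k)
  have [measurable]: "gap k \<in> borel_measurable (info {..<n})" "\<xi> k \<in> borel_measurable (info {..<n})"
    using Suc by (auto intro: X_info)
  show ?case by simp
qed simp

lemma measurable_gap [measurable]: "gap k \<in> borel_measurable M"
  using gap_info[of k k] measurable_info_imp by blast

lemma gap_ge: "j \<le> k \<Longrightarrow> W j \<omega> - W k \<omega> \<le> gap k \<omega>"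
proof (induction k)
  case (Suc k)
  then show ?case by (cases "j = Suc k") (auto simp: W_Suc le_Suc_eq max_def)
qed simp

lemma gap_attained: "\<exists>j\<le>k. gap k \<omega> = W j \<omega> - W k \<omega>"
proof (induction k)
  case (Suc k)
  then obtain j where j: "j \<le> k" "gap k \<omega> = W j \<omega> - W k \<omega>" by blast
  show ?case
  proof (cases "gap k \<omega> - \<xi> k \<omega> \<le> 0")
    case True
    then show ?thesis by (intro exI[of _ "Suc k"]) auto
  next
    case False
    then show ?thesis using j by (intro exI[of _ j]) (auto simp: W_Suc)
  qed
qed simp

text \<open>Truncation at \<open>0\<close> only decreases the square, and the cross term vanishes because \<open>\<xi>\<^sub>k\<close> is centred
  and independent of the gap at time \<open>k\<close>. Hence each step adds at most \<open>\<sigma>\<^sup>2\<close> to the second moment.\<close>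
lemma gap_moments:
  "integrable M (gap k)" "integrable M (\<lambda>\<omega>. (gap k \<omega>)\<^sup>2)"
  "expectation (\<lambda>\<omega>. (gap k \<omega>)\<^sup>2) \<le> \<sigma>\<^sup>2 * k"
proof (induction k)
  case (Suc k)
  let ?f = "\<lambda>\<omega>. (gap k \<omega>)\<^sup>2 - 2 * (gap k \<omega> * \<xi> k \<omega>) + (\<xi> k \<omega>)\<^sup>2"
  have disj: "{..<k} \<inter> {k} = {}" by auto
  note gx = expectation_mult_info[OF disj gap_info[OF order_refl] X_info_single Suc.IH(1) step_moments(3)]
  have int: "integrable M ?f"
    using Suc.IH gx step_moments by auto
  have le: "(gap (Suc k) \<omega>)\<^sup>2 \<le> ?f \<omega>" for \<omega>
  proof -
    have "(gap (Suc k) \<omega>)\<^sup>2 \<le> (gap k \<omega> - \<xi> k \<omega>)\<^sup>2"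
      by (auto simp: max_def)
    then show ?thesis by (simp add: power2_diff algebra_simps)
  qed
  show sq: "integrable M (\<lambda>\<omega>. (gap (Suc k) \<omega>)\<^sup>2)"
    by (rule Bochner_Integration.integrable_bound[OF int])
       (use le in \<open>auto simp del: gap.simps intro!: AE_I2 order_trans[OF le abs_ge_self]\<close>)
  show "integrable M (gap (Suc k))"
    using square_integrable_imp_integrable[OF _ sq] by simp
  have "expectation (\<lambda>\<omega>. (gap (Suc k) \<omega>)\<^sup>2) \<le> expectation ?f"
    using int sq le by (intro integral_mono) auto
  also have "\<dots> = expectation (\<lambda>\<omega>. (gap k \<omega>)\<^sup>2) + \<sigma>\<^sup>2"
    using Suc.IH gx step_moments by simp
  finally show "expectation (\<lambda>\<omega>. (gap (Suc k) \<omega>)\<^sup>2) \<le> \<sigma>\<^sup>2 * real (Suc k)"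
    using Suc.IH(3) by (simp add: algebra_simps)
qed auto

lemma expectation_gap_le: "expectation (gap k) \<le> \<sigma> * sqrt k"
  using expectation_le_sqrt_second_moment[OF gap_moments] \<sigma>_pos by (simp add: real_sqrt_mult)

lemma W_moments: "integrable M (W k)" "expectation (W k) = 0"
  unfolding W_def[abs_def] using step_moments by auto

text \<open>The left side is the running maximum; its increments are the overshoots of the steps over the
  current gap.\<close>
lemma gap_plus_W: "gap n \<omega> + W n \<omega> = (\<Sum>k<n. max 0 (\<xi> k \<omega> - gap k \<omega>))"
  by (induction n) (auto simp: W_Suc max_def)

text \<open>Whenever the gap is \<open>0\<close>, the next step raises the running maximum by its positive part, which has
  mean \<open>\<kappa>\<close> and is independent of the past. The expected maximum equals the expected gap, since the walk
  is centred, and is therefore at most \<open>\<sigma> sqrt n\<close>.\<close>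
lemma sum_prob_gap_zero:
  "\<kappa> * (\<Sum>k<n. prob {\<omega>\<in>space M. gap k \<omega> = 0}) \<le> \<sigma> * sqrt n"
proof -
  let ?g = "\<lambda>k \<omega>. of_bool (gap k \<omega> = 0) * max 0 (\<xi> k \<omega>)"
  have gk: "integrable M (?g k) \<and> expectation (?g k) = prob {\<omega>\<in>space M. gap k \<omega> = 0} * \<kappa>" for k
  proof -
    note [measurable] = gap_info[OF order_refl, of k] X_info_single[of k]
    have disj: "{..<k} \<inter> {k} = {}" by auto
    have "Measurable.pred (info {..<k}) (\<lambda>\<omega>. gap k \<omega> = 0)" by measurable
    then show ?thesis
      using expectation_mult_info[OF disj, of "\<lambda>\<omega>. of_bool (gap k \<omega> = 0)" "\<lambda>\<omega>. max 0 (\<xi> k \<omega>)"]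
      by (simp add: expectation_of_bool integrable_pos_part expectation_pos_part)
  qed
  have "\<kappa> * (\<Sum>k<n. prob {\<omega>\<in>space M. gap k \<omega> = 0}) = expectation (\<lambda>\<omega>. \<Sum>k<n. ?g k \<omega>)"
    using gk by (subst Bochner_Integration.integral_sum) (auto simp: sum_distrib_left mult.commute)
  also have "\<dots> \<le> expectation (\<lambda>\<omega>. gap n \<omega> + W n \<omega>)"
    unfolding gap_plus_W
    by (rule integral_mono)
       (use gk gap_moments(1) step_moments(3) in
         \<open>auto intro!: Bochner_Integration.integrable_sum sum_mono integrable_max simp: of_bool_def\<close>)
  also have "\<dots> \<le> \<sigma> * sqrt n"
    using gap_moments(1) W_moments expectation_gap_le by simp
  finally show ?thesis .
qed

section \<open>Survival above a line of small slope\<close>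

definition alive :: "real \<Rightarrow> nat \<Rightarrow> 'a \<Rightarrow> bool" where
  "alive e n \<omega> \<longleftrightarrow> (\<forall>j\<in>{1..n}. e * j < W j \<omega>)"

lemma alive_info: "n \<le> m \<Longrightarrow> Measurable.pred (info {..<m}) (alive e n)"
proof -
  assume "n \<le> m"
  then have [measurable]: "j \<in> {1..n} \<Longrightarrow> W j \<in> borel_measurable (info {..<m})" for j
    by (intro W_info) auto
  show ?thesis unfolding alive_def[abs_def] by measurable
qed

lemma measurable_alive [measurable]: "Measurable.pred M (alive e n)"
  using alive_info[OF order_refl] measurable_info_imp by blast

lemma alive_mono: "alive e n \<omega> \<Longrightarrow> m \<le> n \<Longrightarrow> alive e m \<omega>"
  by (auto simp: alive_def)

lemma alive_Suc: "alive e (Suc n) \<omega> \<longleftrightarrow> alive e n \<omega> \<and> e * Suc n < W (Suc n) \<omega>"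
  by (auto simp: alive_def atLeastAtMostSuc_conv)

text \<open>Read backwards in time, "all partial sums are positive" becomes "the walk ends strictly above all
  its earlier values", and then it has no gap to its maximum.\<close>
lemma prob_alive_le_gap_zero:
  assumes "0 \<le> e"
  shows "prob {\<omega>\<in>space M. alive e k \<omega>} \<le> prob {\<omega>\<in>space M. gap k \<omega> = 0}"
proof -
  define S where "S j = (if j = 0 then UNIV else {0::real<..})" for j :: nat
  have [measurable]: "S j \<in> sets borel" for j by (simp add: S_def)
  have "prob {\<omega>\<in>space M. alive e k \<omega>} \<le> prob {\<omega>\<in>space M. \<forall>j\<le>k. W j \<omega> \<in> S j}"
  proof (rule finite_measure_mono)
    show "{\<omega> \<in> space M. alive e k \<omega>} \<subseteq> {\<omega>\<in>space M. \<forall>j\<le>k. W j \<omega> \<in> S j}"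
    proof (safe)
      fix \<omega> j assume "alive e k \<omega>" "j \<le> k"
      then have "j \<noteq> 0 \<Longrightarrow> e * j < W j \<omega>" by (auto simp: alive_def)
      moreover have "0 \<le> e * j" using assms by simp
      ultimately show "W j \<omega> \<in> S j" by (force simp: S_def)
    qed
  qed measurable
  also have "\<dots> = prob {\<omega>\<in>space M. \<forall>j\<le>k. W k \<omega> - W (k - j) \<omega> \<in> S j}"
    by (rule prob_walk_reversed[symmetric]) measurable
  also have "\<dots> \<le> prob {\<omega>\<in>space M. gap k \<omega> = 0}"
  proof (rule finite_measure_mono)
    show "{\<omega> \<in> space M. \<forall>j\<le>k. W k \<omega> - W (k - j) \<omega> \<in> S j} \<subseteq> {\<omega> \<in> space M. gap k \<omega> = 0}"
    proof safe
      fix \<omega> assume *: "\<forall>j\<le>k. W k \<omega> - W (k - j) \<omega> \<in> S j"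
      obtain j where j: "j \<le> k" "gap k \<omega> = W j \<omega> - W k \<omega>" using gap_attained by blast
      show "gap k \<omega> = 0"
      proof (cases "j = k")
        case False
        then have "W k \<omega> - W j \<omega> > 0"
          using j(1) *[rule_format, of "k - j"] by (auto simp: S_def)
        then show ?thesis using j gap_nonneg[of k \<omega>] by linarith
      qed (use j in simp)
    qed
  qed measurable
  finally show ?thesis .
qed

lemma sum_prob_alive:
  assumes "0 \<le> e"
  shows "(\<Sum>k<n. prob {\<omega>\<in>space M. alive e k \<omega>}) \<le> \<sigma> / \<kappa> * sqrt n"
proof -
  have "(\<Sum>k<n. prob {\<omega>\<in>space M. alive e k \<omega>}) \<le> (\<Sum>k<n. prob {\<omega>\<in>space M. gap k \<omega> = 0})"
    by (rule sum_mono) (rule prob_alive_le_gap_zero[OF assms])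
  also have "\<dots> \<le> \<sigma> / \<kappa> * sqrt n"
    using sum_prob_gap_zero[of n] \<kappa>_pos by (simp add: field_simps)
  finally show ?thesis .
qed

text \<open>Survival probabilities decrease in \<open>n\<close>, so the last of them is at most the average.\<close>
lemma prob_alive_le:
  assumes "0 \<le> e" "0 < n"
  shows "prob {\<omega>\<in>space M. alive e n \<omega>} \<le> \<sigma> / \<kappa> / sqrt n"
proof -
  have "real n * prob {\<omega>\<in>space M. alive e n \<omega>} = (\<Sum>k<n. prob {\<omega>\<in>space M. alive e n \<omega>})"
    by simp
  also have "\<dots> \<le> (\<Sum>k<n. prob {\<omega>\<in>space M. alive e k \<omega>})"
    by (intro sum_mono finite_measure_mono) (auto intro: alive_mono)
  also have "\<dots> \<le> \<sigma> / \<kappa> * sqrt n" by (rule sum_prob_alive[OF assms(1)])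
  finally have "prob {\<omega>\<in>space M. alive e n \<omega>} \<le> \<sigma> / \<kappa> * sqrt n / n"
    using assms by (subst pos_le_divide_eq) (auto simp: mult.commute)
  also have "\<dots> = \<sigma> / \<kappa> * (sqrt n / n)" by simp
  also have "sqrt (real n) / real n = 1 / sqrt n"
    using assms by (simp add: real_div_sqrt field_simps)
  finally show ?thesis by simp
qed

definition height :: "real \<Rightarrow> nat \<Rightarrow> 'a \<Rightarrow> real" where
  "height e n \<omega> = W n \<omega> - e * n"

lemma height_info: "k \<le> n \<Longrightarrow> height e k \<in> borel_measurable (info {..<n})"
  using W_info[of k n] unfolding height_def[abs_def] by simp

lemma measurable_height [measurable]: "height e k \<in> borel_measurable M"
  unfolding height_def[abs_def] by simp

lemma height_Suc: "height e (Suc n) \<omega> = height e n \<omega> + (\<xi> n \<omega> - e)"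
  by (simp add: height_def W_Suc algebra_simps)

lemma height_alive_nonneg: "alive e n \<omega> \<Longrightarrow> 0 \<le> height e n \<omega>"
  by (cases "n = 0") (auto simp: alive_def height_def dest!: bspec[of _ _ n])

lemma expectation_alive_step:
  assumes f: "f \<in> borel_measurable (info {..<n})" "integrable M f"
    and g[measurable]: "g \<in> borel_measurable borel" and "integrable M (\<lambda>\<omega>. g (\<xi> n \<omega>) :: real)"
  shows "integrable M (\<lambda>\<omega>. (f \<omega> * of_bool (alive e n \<omega>)) * g (\<xi> n \<omega>))"
    and "expectation (\<lambda>\<omega>. (f \<omega> * of_bool (alive e n \<omega>)) * g (\<xi> n \<omega>))
      = expectation (\<lambda>\<omega>. f \<omega> * of_bool (alive e n \<omega>)) * expectation (\<lambda>\<omega>. g (\<xi> n \<omega>))"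
proof -
  note [measurable] = f(1) alive_info[of n n e, OF order_refl] X_info_single[of n]
  have disj: "{..<n} \<inter> {n} = {}" by auto
  have "(\<lambda>\<omega>. f \<omega> * of_bool (alive e n \<omega>)) \<in> borel_measurable (info {..<n})"
    by measurable
  moreover have "(\<lambda>\<omega>. g (\<xi> n \<omega>)) \<in> borel_measurable (info {n})" by measurable
  moreover have "integrable M (\<lambda>\<omega>. f \<omega> * of_bool (alive e n \<omega>))"
    by (rule integrable_mult_of_bool[OF f(2)]) measurable
  ultimately show "integrable M (\<lambda>\<omega>. (f \<omega> * of_bool (alive e n \<omega>)) * g (\<xi> n \<omega>))"
    and "expectation (\<lambda>\<omega>. (f \<omega> * of_bool (alive e n \<omega>)) * g (\<xi> n \<omega>))
      = expectation (\<lambda>\<omega>. f \<omega> * of_bool (alive e n \<omega>)) * expectation (\<lambda>\<omega>. g (\<xi> n \<omega>))"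
    using expectation_mult_info[OF disj] assms(4) by blast+
qed

lemma shifted_step_moments:
  "integrable M (\<lambda>\<omega>. \<xi> n \<omega> - e)" "expectation (\<lambda>\<omega>. \<xi> n \<omega> - e) = - e"
  "integrable M (\<lambda>\<omega>. (\<xi> n \<omega> - e)\<^sup>2)" "expectation (\<lambda>\<omega>. (\<xi> n \<omega> - e)\<^sup>2) = \<sigma>\<^sup>2 + e\<^sup>2"
proof -
  show "integrable M (\<lambda>\<omega>. \<xi> n \<omega> - e)" "expectation (\<lambda>\<omega>. \<xi> n \<omega> - e) = - e"
    using step_moments[of n] by (auto simp: prob_space)
  have eq: "(\<lambda>\<omega>. (\<xi> n \<omega> - e)\<^sup>2) = (\<lambda>\<omega>. (\<xi> n \<omega>)\<^sup>2 - (2 * e) * \<xi> n \<omega> + e\<^sup>2)"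
    by (auto simp: power2_diff algebra_simps)
  show "integrable M (\<lambda>\<omega>. (\<xi> n \<omega> - e)\<^sup>2)" "expectation (\<lambda>\<omega>. (\<xi> n \<omega> - e)\<^sup>2) = \<sigma>\<^sup>2 + e\<^sup>2"
    unfolding eq using step_moments[of n] by (auto simp: prob_space)
qed

lemma integrable_height: "integrable M (height e n)"
  unfolding height_def[abs_def] using W_moments by auto

lemma integrable_height_sq: "integrable M (\<lambda>\<omega>. (height e n \<omega>)\<^sup>2)"
proof (induction n)
  case (Suc n)
  have disj: "{..<n} \<inter> {n} = {}" by auto
  have g: "(\<lambda>\<omega>. \<xi> n \<omega> - e) \<in> borel_measurable (info {n})"
    using X_info_single[of n] by simp
  have eq: "(\<lambda>\<omega>. (height e (Suc n) \<omega>)\<^sup>2)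
      = (\<lambda>\<omega>. (height e n \<omega>)\<^sup>2 + 2 * (height e n \<omega> * (\<xi> n \<omega> - e)) + (\<xi> n \<omega> - e)\<^sup>2)"
    unfolding height_Suc by (auto simp: power2_sum)
  show ?case
    unfolding eq
    using Suc shifted_step_moments
      expectation_mult_info(1)[OF disj height_info[OF order_refl] g integrable_height]
    by (intro Bochner_Integration.integrable_add) auto
qed (simp add: height_def)

text \<open>On survival the height loses \<open>e\<close> per step on average, and discarding the paths that die, which
  have nonpositive height at that moment, can only increase the expectation. The starting value
  \<open>\<kappa>\<close> comes from the very first step, which discards the negative part of \<open>\<xi>\<^sub>0 - e\<close>.\<close>
lemma first_moment_alive:
  assumes "0 < n" "0 \<le> e"
  shows "\<kappa> - e * (\<Sum>k<n. prob {\<omega>\<in>space M. alive e k \<omega>})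
    \<le> expectation (\<lambda>\<omega>. height e n \<omega> * of_bool (alive e n \<omega>))"
  using assms(1)
proof (induction n rule: nat_induct_non_zero)
  case 1
  have "\<kappa> - e = expectation (\<lambda>\<omega>. max 0 (\<xi> 0 \<omega>) - e)"
    using integrable_pos_part[of 0] expectation_pos_part[of 0] by (simp add: prob_space)
  also have "\<dots> \<le> expectation (\<lambda>\<omega>. height e 1 \<omega> * of_bool (alive e 1 \<omega>))"
  proof (rule integral_mono)
    show "integrable M (\<lambda>\<omega>. height e 1 \<omega> * of_bool (alive e 1 \<omega>))"
      by (rule integrable_mult_of_bool[OF integrable_height]) measurable
    show "max 0 (\<xi> 0 \<omega>) - e \<le> height e 1 \<omega> * of_bool (alive e 1 \<omega>)" for \<omega>
      using assms(2) by (auto simp: height_def alive_def W_def of_bool_def)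
  qed (use integrable_pos_part[of 0] in auto)
  finally show ?case by (simp add: alive_def prob_space)
next
  case (Suc n)
  let ?a = "\<lambda>\<omega>. of_bool (alive e n \<omega>) :: real"
  have one: "(\<lambda>_. 1::real) \<in> borel_measurable (info {..<n})" by simp
  note s = expectation_alive_step[OF one _ _ , of "\<lambda>x. x - e" e]
  have s1: "integrable M (\<lambda>\<omega>. ?a \<omega> * (\<xi> n \<omega> - e))"
    "expectation (\<lambda>\<omega>. ?a \<omega> * (\<xi> n \<omega> - e)) = prob {\<omega>\<in>space M. alive e n \<omega>} * (- e)"
    using s shifted_step_moments by (simp_all add: expectation_of_bool)
  have h: "integrable M (\<lambda>\<omega>. height e n \<omega> * ?a \<omega>)"
    by (rule integrable_mult_of_bool[OF integrable_height]) measurable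
  have "expectation (\<lambda>\<omega>. height e n \<omega> * ?a \<omega>) - e * prob {\<omega>\<in>space M. alive e n \<omega>}
    = expectation (\<lambda>\<omega>. height e n \<omega> * ?a \<omega> + ?a \<omega> * (\<xi> n \<omega> - e))"
    using s1 h by simp
  also have "\<dots> \<le> expectation (\<lambda>\<omega>. height e (Suc n) \<omega> * of_bool (alive e (Suc n) \<omega>))"
  proof (rule integral_mono)
    show "integrable M (\<lambda>\<omega>. height e (Suc n) \<omega> * of_bool (alive e (Suc n) \<omega>))"
      by (rule integrable_mult_of_bool[OF integrable_height]) measurable
    show "height e n \<omega> * ?a \<omega> + ?a \<omega> * (\<xi> n \<omega> - e)
      \<le> height e (Suc n) \<omega> * of_bool (alive e (Suc n) \<omega>)" for \<omega>
      unfolding alive_Suc height_Suc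
      by (auto simp: of_bool_def height_def W_Suc algebra_simps)
  qed (use s1 h in auto)
  finally show ?case using Suc by (simp add: algebra_simps)
qed

text \<open>Each surviving step adds at most the second moment \<open>\<sigma>\<^sup>2 + e\<^sup>2\<close> of \<open>\<xi>\<^sub>n - e\<close>: the cross term is
  \<open>-2e\<close> times a nonnegative expectation, and dead paths only lose mass.\<close>
lemma second_moment_alive:
  assumes "0 \<le> e"
  shows "expectation (\<lambda>\<omega>. (height e n \<omega>)\<^sup>2 * of_bool (alive e n \<omega>))
    \<le> (\<sigma>\<^sup>2 + e\<^sup>2) * (\<Sum>k<n. prob {\<omega>\<in>space M. alive e k \<omega>})"
proof (induction n)
  case (Suc n)
  let ?a = "\<lambda>\<omega>. of_bool (alive e n \<omega>) :: real"
  let ?h = "height e n" and ?s = "\<lambda>\<omega>. \<xi> n \<omega> - e"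
  have one: "(\<lambda>_. 1::real) \<in> borel_measurable (info {..<n})" by simp
  have s1: "integrable M (\<lambda>\<omega>. ?a \<omega> * (?s \<omega>)\<^sup>2)"
    "expectation (\<lambda>\<omega>. ?a \<omega> * (?s \<omega>)\<^sup>2) = prob {\<omega>\<in>space M. alive e n \<omega>} * (\<sigma>\<^sup>2 + e\<^sup>2)"
    using expectation_alive_step[OF one _ _ , of "\<lambda>x. (x - e)\<^sup>2" e] shifted_step_moments
    by (simp_all add: expectation_of_bool)
  have s2: "integrable M (\<lambda>\<omega>. (?h \<omega> * ?a \<omega>) * ?s \<omega>)"
    "expectation (\<lambda>\<omega>. (?h \<omega> * ?a \<omega>) * ?s \<omega>) = expectation (\<lambda>\<omega>. ?h \<omega> * ?a \<omega>) * (- e)"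
    using expectation_alive_step[OF height_info[OF order_refl] integrable_height, of "\<lambda>x. x - e" n e e]
      shifted_step_moments by simp_all
  have s3: "integrable M (\<lambda>\<omega>. (?h \<omega>)\<^sup>2 * ?a \<omega>)"
    by (rule integrable_mult_of_bool[OF integrable_height_sq]) measurable
  have "0 \<le> expectation (\<lambda>\<omega>. ?h \<omega> * ?a \<omega>)"
    by (rule Bochner_Integration.integral_nonneg) (auto simp: of_bool_def height_alive_nonneg)
  then have nn: "0 \<le> expectation (\<lambda>\<omega>. ?h \<omega> * ?a \<omega>) * e" using assms by simp
  have "expectation (\<lambda>\<omega>. (height e (Suc n) \<omega>)\<^sup>2 * of_bool (alive e (Suc n) \<omega>))
    \<le> expectation (\<lambda>\<omega>. (?h \<omega>)\<^sup>2 * ?a \<omega> + 2 * ((?h \<omega> * ?a \<omega>) * ?s \<omega>) + ?a \<omega> * (?s \<omega>)\<^sup>2)"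
  proof (rule integral_mono)
    show "integrable M (\<lambda>\<omega>. (height e (Suc n) \<omega>)\<^sup>2 * of_bool (alive e (Suc n) \<omega>))"
      by (rule integrable_mult_of_bool[OF integrable_height_sq]) measurable
    show "integrable M (\<lambda>\<omega>. (?h \<omega>)\<^sup>2 * ?a \<omega> + 2 * ((?h \<omega> * ?a \<omega>) * ?s \<omega>) + ?a \<omega> * (?s \<omega>)\<^sup>2)"
      using s1(1) s2(1) s3 by (intro Bochner_Integration.integrable_add integrable_mult_right) auto
    show "(height e (Suc n) \<omega>)\<^sup>2 * of_bool (alive e (Suc n) \<omega>)
      \<le> (?h \<omega>)\<^sup>2 * ?a \<omega> + 2 * ((?h \<omega> * ?a \<omega>) * ?s \<omega>) + ?a \<omega> * (?s \<omega>)\<^sup>2" for \<omega>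
    proof (cases "alive e n \<omega>")
      case True
      then have "(?h \<omega>)\<^sup>2 * ?a \<omega> + 2 * ((?h \<omega> * ?a \<omega>) * ?s \<omega>) + ?a \<omega> * (?s \<omega>)\<^sup>2
        = (height e (Suc n) \<omega>)\<^sup>2"
        by (simp add: height_Suc power2_sum)
      then show ?thesis by (simp add: of_bool_def)
    qed (simp add: alive_Suc)
  qed
  also have "\<dots> = expectation (\<lambda>\<omega>. (?h \<omega>)\<^sup>2 * ?a \<omega>)
      + 2 * (expectation (\<lambda>\<omega>. ?h \<omega> * ?a \<omega>) * (- e)) + prob {\<omega>\<in>space M. alive e n \<omega>} * (\<sigma>\<^sup>2 + e\<^sup>2)"
    using s1 s2 s3 by simp
  finally show ?case using Suc nn by (simp add: algebra_simps)
qed (simp add: height_def)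

text \<open>Chosen so that, for \<open>e sqrt n \<le> \<eta>\<close>, the loss due to the drift and the contribution of surviving
  paths below \<open>\<eta> sqrt n\<close> each cost at most \<open>\<kappa> / 4\<close> of the first moment.\<close>
definition \<eta> :: real where
  "\<eta> = \<kappa>\<^sup>2 / (4 * \<sigma>)"

lemma \<eta>_pos: "0 < \<eta>"
  using \<kappa>_pos \<sigma>_pos by (simp add: \<eta>_def)

text \<open>At least half of \<open>\<kappa>\<close> remains as the first moment of the height over surviving paths above
  \<open>\<eta> sqrt n\<close>, while the second moment is at most of order \<open>sqrt n\<close>. By Cauchy-Schwarz, the event
  must have probability of order at least \<open>1 / sqrt n\<close>.\<close>
lemma prob_alive_high:
  assumes n: "0 < n" and e: "0 \<le> e" "e \<le> 1" and small: "e * sqrt n \<le> \<eta>"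
  shows "\<kappa> ^ 3 / (4 * \<sigma> * (\<sigma>\<^sup>2 + 1)) / sqrt n
    \<le> prob {\<omega>\<in>space M. alive e n \<omega> \<and> \<eta> * sqrt n \<le> height e n \<omega>}"
proof -
  define p where "p = prob {\<omega>\<in>space M. alive e n \<omega> \<and> \<eta> * sqrt n \<le> height e n \<omega>}"
  define V where "V = (\<sigma>\<^sup>2 + 1) * (\<sigma> / \<kappa>) * sqrt n"
  define l where "l = 2 * V / \<kappa>"
  let ?a = "\<lambda>\<omega>. of_bool (alive e n \<omega>) :: real"
  let ?g = "\<lambda>\<omega>. of_bool (alive e n \<omega> \<and> \<eta> * sqrt n \<le> height e n \<omega>) :: real"
  let ?h = "height e n"
  note pos = \<kappa>_pos \<sigma>_pos \<eta>_pos
  have "0 < \<sigma>\<^sup>2 + 1" by (intro add_nonneg_pos) auto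
  then have V: "0 < V" using pos n by (simp add: V_def)
  then have l: "0 < l" using pos by (simp add: l_def)
  have "(\<sigma>\<^sup>2 + e\<^sup>2) * (\<Sum>k<n. prob {\<omega>\<in>space M. alive e k \<omega>}) \<le> (\<sigma>\<^sup>2 + 1) * (\<sigma> / \<kappa> * sqrt n)"
    using sum_prob_alive[OF e(1), of n] e pos
    by (intro mult_mono) (auto simp: power_le_one sum_nonneg)
  then have m2: "expectation (\<lambda>\<omega>. (?h \<omega>)\<^sup>2 * ?a \<omega>) \<le> V"
    using second_moment_alive[OF e(1), of n] by (simp add: V_def mult.assoc)
  have "e * (\<Sum>k<n. prob {\<omega>\<in>space M. alive e k \<omega>}) \<le> e * (\<sigma> / \<kappa> * sqrt n)"
    using sum_prob_alive[OF e(1), of n] e by (intro mult_left_mono) auto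
  also have "\<dots> = \<sigma> / \<kappa> * (e * sqrt n)" by simp
  also have "\<dots> \<le> \<sigma> / \<kappa> * \<eta>" using small pos by (intro mult_left_mono) auto
  also have "\<dots> = \<kappa> / 4" using pos by (simp add: \<eta>_def power2_eq_square)
  finally have m1: "3 * \<kappa> / 4 \<le> expectation (\<lambda>\<omega>. ?h \<omega> * ?a \<omega>)"
    using first_moment_alive[OF n e(1)] by linarith
  have "(\<eta> * sqrt n) * prob {\<omega>\<in>space M. alive e n \<omega>} \<le> (\<eta> * sqrt n) * (\<sigma> / \<kappa> / sqrt n)"
    using prob_alive_le[OF e(1) n] pos by (intro mult_left_mono) auto
  also have "\<dots> = \<kappa> / 4" using pos n by (simp add: \<eta>_def power2_eq_square)
  finally have m0: "(\<eta> * sqrt n) * prob {\<omega>\<in>space M. alive e n \<omega>} \<le> \<kappa> / 4" .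
  have int: "integrable M (\<lambda>\<omega>. ?h \<omega> * ?a \<omega>)" "integrable M (\<lambda>\<omega>. (?h \<omega>)\<^sup>2 * ?a \<omega>)"
    "integrable M ?a" "integrable M ?g"
    by (rule integrable_mult_of_bool integrable_height integrable_height_sq expectation_of_bool; measurable)+
  (* Cauchy-Schwarz in the linear form h \<le> h\<^sup>2 / (2 l) + l / 2, applied above the level only; the value
     of l makes the quadratic term at most \<kappa> / 4. *)
  have "expectation (\<lambda>\<omega>. ?h \<omega> * ?a \<omega>) \<le> expectation (\<lambda>\<omega>. (\<eta> * sqrt n) * ?a \<omega>
      + ((?h \<omega>)\<^sup>2 * ?a \<omega> * (1 / (2 * l)) + l / 2 * ?g \<omega>))"
  proof (rule integral_mono)
    fix \<omega>
    have "2 * (?h \<omega> * l) \<le> (?h \<omega>)\<^sup>2 + l\<^sup>2"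
      using sum_squares_bound[of "?h \<omega>" l] by simp
    then have "?h \<omega> \<le> (?h \<omega>)\<^sup>2 * (1 / (2 * l)) + l / 2"
      using l by (simp add: field_simps power2_eq_square)
    moreover have "0 \<le> (?h \<omega>)\<^sup>2 * (1 / (2 * l))" using l by simp
    moreover have "0 \<le> \<eta> * sqrt n" using pos by simp
    ultimately show "?h \<omega> * ?a \<omega> \<le> (\<eta> * sqrt n) * ?a \<omega>
      + ((?h \<omega>)\<^sup>2 * ?a \<omega> * (1 / (2 * l)) + l / 2 * ?g \<omega>)"
      by (auto simp: of_bool_def)
  qed (use int in \<open>auto intro!: Bochner_Integration.integrable_add\<close>)
  also have "\<dots> = (\<eta> * sqrt n) * prob {\<omega>\<in>space M. alive e n \<omega>}
      + (expectation (\<lambda>\<omega>. (?h \<omega>)\<^sup>2 * ?a \<omega>) * (1 / (2 * l)) + l / 2 * p)"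
    using int by (simp add: expectation_of_bool p_def del: times_divide_eq_right)
  also have "expectation (\<lambda>\<omega>. (?h \<omega>)\<^sup>2 * ?a \<omega>) * (1 / (2 * l)) \<le> V * (1 / (2 * l))"
    using m2 l by (intro mult_right_mono) auto
  also have "V * (1 / (2 * l)) = \<kappa> / 4" using V pos by (simp add: l_def)
  finally have "\<kappa> / 4 \<le> l / 2 * p" using m0 m1 by linarith
  then have "\<kappa> / (2 * l) \<le> p" using l by (simp add: field_simps)
  also have "\<kappa> / (2 * l) = \<kappa> ^ 3 / (4 * \<sigma> * (\<sigma>\<^sup>2 + 1)) / sqrt n"
    using pos by (simp add: l_def V_def power3_eq_cube mult.assoc mult.commute mult.left_commute)
  finally show ?thesis by (simp add: p_def)
qed

end

section \<open>Prolonging survival by blocks\<close>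

lemma std_normal_cdf_less_1: "cdf std_normal_distribution x < 1"
  and std_normal_no_atom: "measure std_normal_distribution {x} = 0"
proof -
  interpret N: real_distribution std_normal_distribution by (rule real_dist_normal_dist)
  have "AE y in lborel. y \<in> {x} \<longrightarrow> ennreal (std_normal_density y) = 0"
    using AE_lborel_singleton[of x] by eventually_elim auto
  then have "{x} \<in> null_sets std_normal_distribution"
    by (subst null_sets_density_iff) auto
  then show "measure std_normal_distribution {x} = 0"
    by (auto simp: null_sets_def measure_def)
  have "\<not> (AE y in lborel. y \<in> {x<..} \<longrightarrow> ennreal (std_normal_density y) = 0)"
  proof
    assume "AE y in lborel. y \<in> {x<..} \<longrightarrow> ennreal (std_normal_density y) = 0"
    then have "AE y in lborel. y \<notin> {x<..}"
      using normal_density_pos[of 1 0] by (auto simp: ennreal_eq_0_iff not_le[symmetric])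
    then have "emeasure lborel {x<..} = 0"
      by (subst (asm) AE_iff_measurable[of "{x<..}"]) auto
    moreover have "emeasure lborel {x<..<x+1} \<le> emeasure lborel {x<..}"
      by (rule emeasure_mono) auto
    ultimately show False by simp
  qed
  then have "{x<..} \<notin> null_sets std_normal_distribution"
    by (subst null_sets_density_iff) auto
  then have "measure std_normal_distribution {x<..} \<noteq> 0"
    by (auto simp: null_sets_def N.emeasure_eq_measure)
  then have "0 < measure std_normal_distribution {x<..}"
    by (simp add: less_le)
  also have "measure std_normal_distribution {x<..} = 1 - cdf std_normal_distribution x"
  proof -
    have "{x<..} = space std_normal_distribution - {..x}" by auto
    then show ?thesis
      unfolding cdf_def by (metis N.prob_compl N.events_eq_borel atMost_borel)
  qed
  finally show "cdf std_normal_distribution x < 1" by simp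
qed

context centered_walk begin

text \<open>By the central limit theorem the probabilities converge to that of a standard normal variable
  exceeding \<open>1 / \<sigma>\<close>.\<close>
lemma prob_W_ge_sqrt:
  "\<exists>c>0. eventually (\<lambda>m. c \<le> prob {\<omega>\<in>space M. sqrt m \<le> W m \<omega>}) sequentially"
proof -
  define F where "F m = distr M borel (\<lambda>\<omega>. W m \<omega> / sqrt (m * \<sigma>\<^sup>2))" for m :: nat
  define p where "p = 1 - cdf std_normal_distribution (1 / \<sigma>)"
  interpret N: real_distribution std_normal_distribution by (rule real_dist_normal_dist)
  have p: "0 < p" using std_normal_cdf_less_1 by (simp add: p_def)
  have "weak_conv_m F std_normal_distribution"
    unfolding F_def W_def
  proof (rule central_limit_theorem_zero_mean)
    show "indep_vars (\<lambda>i. borel) \<xi> UNIV" by (rule indep)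
    show "variance (\<xi> n) = \<sigma>\<^sup>2" for n using step_moments[of n] by simp
  qed (use \<sigma>_pos step_moments ident in auto)
  then have "(\<lambda>m. cdf (F m) (1 / \<sigma>)) \<longlonglongrightarrow> cdf std_normal_distribution (1 / \<sigma>)"
    unfolding weak_conv_m_def weak_conv_def using N.isCont_cdf std_normal_no_atom by blast
  then have "eventually (\<lambda>m. cdf (F m) (1 / \<sigma>) < 1 - p / 2) sequentially"
    by (rule order_tendstoD) (use p in \<open>simp add: p_def field_simps\<close>)
  then have "eventually (\<lambda>m. p / 2 \<le> prob {\<omega>\<in>space M. sqrt m \<le> W m \<omega>}) sequentially"
    using eventually_gt_at_top[of 0]
  proof eventually_elim
    case (elim m)
    let ?A = "{\<omega>\<in>space M. W m \<omega> / sqrt (m * \<sigma>\<^sup>2) \<le> 1 / \<sigma>}"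
    have "cdf (F m) (1 / \<sigma>) = prob ((\<lambda>\<omega>. W m \<omega> / sqrt (m * \<sigma>\<^sup>2)) -` {..1/\<sigma>} \<inter> space M)"
      unfolding cdf_def F_def by (rule measure_distr) auto
    also have "(\<lambda>\<omega>. W m \<omega> / sqrt (m * \<sigma>\<^sup>2)) -` {..1/\<sigma>} \<inter> space M = ?A" by auto
    finally have "p / 2 \<le> 1 - prob ?A" using elim by simp
    also have "\<dots> = prob (space M - ?A)" by (rule prob_compl[symmetric]) measurable
    also have "\<dots> \<le> prob {\<omega>\<in>space M. sqrt m \<le> W m \<omega>}"
      using \<sigma>_pos elim
      by (intro finite_measure_mono) (auto simp: real_sqrt_mult field_simps)
    finally show ?case .
  qed
  then show ?thesis using p by (intro exI[of _ "p / 2"]) auto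
qed

text \<open>Time reversal turns the depth of the minimum of the walk into the gap below its maximum, whose
  mean is at most \<open>\<sigma> sqrt m\<close>, and Markov's inequality does the rest.\<close>
lemma prob_W_stays_above:
  fixes m :: nat
  assumes h: "0 < h"
  shows "1 - \<sigma> * sqrt m / h \<le> prob {\<omega>\<in>space M. \<forall>j\<le>m. - h < W j \<omega>}"
proof -
  have "prob {\<omega>\<in>space M. h \<le> gap m \<omega>} \<le> expectation (gap m) / h"
    using integral_Markov_inequality_measure[OF gap_moments(1) _ _ h, of "{}" m] gap_nonneg
    by simp
  also have "\<dots> \<le> \<sigma> * sqrt m / h"
    using expectation_gap_le h by (simp add: divide_right_mono)
  finally have "1 - \<sigma> * sqrt m / h \<le> 1 - prob {\<omega>\<in>space M. h \<le> gap m \<omega>}" by simp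
  also have "\<dots> = prob (space M - {\<omega>\<in>space M. h \<le> gap m \<omega>})"
    by (rule prob_compl[symmetric]) measurable
  also have "\<dots> \<le> prob {\<omega>\<in>space M. \<forall>j\<le>m. W m \<omega> - W (m - j) \<omega> \<in> {- h<..}}"
  proof (rule finite_measure_mono)
    have "- h < W m \<omega> - W (m - j) \<omega>" if "\<not> h \<le> gap m \<omega>" for \<omega> j
      using gap_ge[of "m - j" m \<omega>] that by linarith
    then show "space M - {\<omega>\<in>space M. h \<le> gap m \<omega>}
        \<subseteq> {\<omega>\<in>space M. \<forall>j\<le>m. W m \<omega> - W (m - j) \<omega> \<in> {- h<..}}" by auto
  qed measurable
  also have "\<dots> = prob {\<omega>\<in>space M. \<forall>j\<le>m. W j \<omega> \<in> {- h<..}}"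
    by (rule prob_walk_reversed) auto
  finally show ?thesis by simp
qed

text \<open>A good block of \<open>m\<close> steps started at time \<open>n\<close>: the walk loses less than \<open>K sqrt m\<close> on the way and
  gains at least \<open>sqrt m\<close> in the end.\<close>
definition block :: "real \<Rightarrow> nat \<Rightarrow> nat \<Rightarrow> 'a \<Rightarrow> bool" where
  "block K m n \<omega> \<longleftrightarrow> (\<forall>j\<le>m. - K * sqrt m < W (n + j) \<omega> - W n \<omega>) \<and> sqrt m \<le> W (n + m) \<omega> - W n \<omega>"

lemma measurable_block [measurable]: "Measurable.pred M (block K m n)"
  unfolding block_def[abs_def] by measurable

lemma block_info: "Measurable.pred (info {n..}) (block K m n)"
proof -
  have "W (n + j) \<omega> - W n \<omega> = (\<Sum>i<j. \<xi> (n + i) \<omega>)" for j \<omega>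
    by (induction j) (auto simp: W_Suc)
  moreover have [measurable]: "(\<lambda>\<omega>. \<Sum>i<j. \<xi> (n + i) \<omega>) \<in> borel_measurable (info {n..})" for j
    by (intro borel_measurable_sum X_info) auto
  ultimately show ?thesis unfolding block_def[abs_def] by simp
qed

lemma prob_block_shift:
  "prob {\<omega>\<in>space M. block K m n \<omega>} = prob {\<omega>\<in>space M. block K m 0 \<omega>}"
proof -
  define S where "S j = (if j = m then {- K * sqrt m<..} \<inter> {sqrt m..} else {- K * sqrt m<..})" for j
  have S: "S j \<in> sets borel" for j by (simp add: S_def)
  have "block K m n \<omega> \<longleftrightarrow> (\<forall>j\<le>m. W (n + j) \<omega> - W n \<omega> \<in> S j)" for n \<omega>
    by (auto simp: block_def S_def)
  then show ?thesis
    using prob_walk_shifted[of S m n, OF S] prob_walk_shifted[of S m 0, OF S] by simp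
qed

text \<open>The gain has probability at least some \<open>c\<close>, and \<open>K\<close> is chosen so large that dipping by \<open>K sqrt m\<close>
  has probability at most \<open>c / 2\<close>.\<close>
lemma prob_block:
  "\<exists>c K m0. 0 < c \<and> 0 < K \<and> (\<forall>m\<ge>m0. \<forall>n. c \<le> prob {\<omega>\<in>space M. block K m n \<omega>})"
proof -
  obtain c where c: "0 < c" 
    and ev: "eventually (\<lambda>m. c \<le> prob {\<omega>\<in>space M. sqrt m \<le> W m \<omega>}) sequentially"
    using prob_W_ge_sqrt by blast
  obtain m0 where m0: "\<And>m. m0 \<le> m \<Longrightarrow> c \<le> prob {\<omega>\<in>space M. sqrt m \<le> W m \<omega>}"
    using ev by (auto simp: eventually_sequentially)
  define K where "K = 2 * \<sigma> / c"
  have K: "0 < K" using c \<sigma>_pos by (simp add: K_def)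
  have "c / 2 \<le> prob {\<omega>\<in>space M. block K m n \<omega>}" if m: "max 1 m0 \<le> m" for m n
  proof -
    let ?A = "{\<omega>\<in>space M. \<forall>j\<le>m. - (K * sqrt m) < W j \<omega>}"
    let ?B = "{\<omega>\<in>space M. sqrt m \<le> W m \<omega>}"
    have "1 - c / 2 \<le> prob ?A"
      using prob_W_stays_above[of "K * sqrt m" m] K m \<sigma>_pos c by (simp add: K_def)
    moreover have "c \<le> prob ?B" using m0 m by simp
    moreover have "prob ?A + prob ?B \<le> 1 + prob (?A \<inter> ?B)"
    proof -
      have "prob (?A \<union> ?B) = prob ?A + prob ?B - prob (?A \<inter> ?B)"
        by (rule measure_Un3) (auto simp: fmeasurable_eq_sets)
      then show ?thesis using prob_le_1[of "?A \<union> ?B"] by linarith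
    qed
    moreover have "?A \<inter> ?B = {\<omega>\<in>space M. block K m 0 \<omega>}"
      by (auto simp: block_def)
    ultimately show ?thesis unfolding prob_block_shift[of K m n] by simp
  qed
  then show ?thesis using c K
    by (intro exI[of _ "c / 2"] exI[of _ K] exI[of _ "max 1 m0"]) auto
qed

text \<open>The line rises by at most \<open>e m \<le> sqrt m\<close> during a block. A margin of \<open>(K + 1) sqrt m\<close> therefore
  covers both the dip of the walk and the rise of the line, and the final gain of \<open>sqrt m\<close> restores the
  margin for the next block.\<close>
lemma prob_alive_append_block:
  assumes "e * m \<le> sqrt m" "0 \<le> e" and h: "(K + 1) * sqrt m \<le> h"
  shows "prob {\<omega>\<in>space M. alive e n \<omega> \<and> h \<le> height e n \<omega>} * prob {\<omega>\<in>space M. block K m n \<omega>}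
    \<le> prob {\<omega>\<in>space M. alive e (n + m) \<omega> \<and> h \<le> height e (n + m) \<omega>}"
proof -
  note [measurable] = alive_info[of n n e, OF order_refl] height_info[of n n e, OF order_refl]
  have "prob {\<omega>\<in>space M. alive e n \<omega> \<and> h \<le> height e n \<omega>} * prob {\<omega>\<in>space M. block K m n \<omega>}
    = prob {\<omega>\<in>space M. (alive e n \<omega> \<and> h \<le> height e n \<omega>) \<and> block K m n \<omega>}"
    by (rule prob_conj_info[symmetric, of "{..<n}" "{n..}"]) (auto intro!: block_info)
  also have "\<dots> \<le> prob {\<omega>\<in>space M. alive e (n + m) \<omega> \<and> h \<le> height e (n + m) \<omega>}"
  proof (rule finite_measure_mono)
    have "alive e (n + m) \<omega> \<and> h \<le> height e (n + m) \<omega>"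
      if a: "alive e n \<omega>" "h \<le> height e n \<omega>" "block K m n \<omega>" for \<omega>
    proof
      show "h \<le> height e (n + m) \<omega>"
        using a assms by (auto simp: block_def height_def algebra_simps)
      show "alive e (n + m) \<omega>"
        unfolding alive_def
      proof
        fix k assume k: "k \<in> {1..n + m}"
        show "e * k < W k \<omega>"
        proof (cases "k \<le> n")
          case True
          then show ?thesis using a k by (auto simp: alive_def)
        next
          case False
          define j where "j = k - n"
          have j: "k = n + j" "j \<le> m" using k False by (auto simp: j_def)
          have "e * j \<le> e * m" using j assms by (intro mult_left_mono) auto
          moreover have "- K * sqrt m < W (n + j) \<omega> - W n \<omega>"
            using a(3) j by (simp add: block_def)
          ultimately show ?thesis
            using a(2) h assms(1) unfolding j height_def by (simp add: algebra_simps)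
        qed
      qed
    qed
    then show "{\<omega>\<in>space M. (alive e n \<omega> \<and> h \<le> height e n \<omega>) \<and> block K m n \<omega>}
      \<subseteq> {\<omega>\<in>space M. alive e (n + m) \<omega> \<and> h \<le> height e (n + m) \<omega>}" by blast
  qed measurable
  finally show ?thesis .
qed

lemma prob_alive_append_blocks:
  assumes "e * m \<le> sqrt m" "0 \<le> e" and h: "(K + 1) * sqrt m \<le> h"
    and c: "0 \<le> c" "\<And>n. c \<le> prob {\<omega>\<in>space M. block K m n \<omega>}"
  shows "prob {\<omega>\<in>space M. alive e n \<omega> \<and> h \<le> height e n \<omega>} * c ^ r
    \<le> prob {\<omega>\<in>space M. alive e (n + r * m) \<omega> \<and> h \<le> height e (n + r * m) \<omega>}"
proof (induction r)
  case (Suc r)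
  have "prob {\<omega>\<in>space M. alive e n \<omega> \<and> h \<le> height e n \<omega>} * c ^ Suc r
    \<le> prob {\<omega>\<in>space M. alive e (n + r * m) \<omega> \<and> h \<le> height e (n + r * m) \<omega>} * c"
    using mult_right_mono[OF Suc c(1)] by (simp add: ac_simps)
  also have "\<dots> \<le> prob {\<omega>\<in>space M. alive e (n + r * m) \<omega> \<and> h \<le> height e (n + r * m) \<omega>}
      * prob {\<omega>\<in>space M. block K m (n + r * m) \<omega>}"
    by (intro mult_left_mono c(2)) auto
  also have "\<dots> \<le> prob {\<omega>\<in>space M. alive e (n + r * m + m) \<omega> \<and> h \<le> height e (n + r * m + m) \<omega>}"
    by (rule prob_alive_append_block[OF assms(1-3)])
  finally show ?case by (simp add: ac_simps)
qed simp

text \<open>The first stretch of \<open>n\<close> steps ends at height \<open>\<eta> sqrt n\<close> with probability of order \<open>1 / sqrt n\<close>,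
  that is of order \<open>e\<close>, when \<open>n\<close> is a small multiple of \<open>1 / e\<^sup>2\<close>. Blocks of \<open>m = n / q\<close> steps with a
  fixed large \<open>q\<close> fit under this height, and a number \<open>r\<close> of them that does not depend on \<open>e\<close>
  covers the time up to \<open>Y / e\<^sup>2\<close>, at the price of the constant factor \<open>c ^ r\<close>.\<close>
theorem prob_above_line_ge:
  assumes Y: "0 < Y"
  shows "\<exists>c>0. \<exists>e0>0. \<forall>e. 0 < e \<and> e \<le> e0 \<longrightarrow>
    c * e \<le> prob {\<omega>\<in>space M. alive e (nat \<lfloor>Y / e\<^sup>2\<rfloor>) \<omega>}"
proof -
  obtain c K m0 where c: "0 < c" and K: "0 < K"
    and blk: "\<And>m n. m0 \<le> m \<Longrightarrow> c \<le> prob {\<omega>\<in>space M. block K m n \<omega>}"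
    using prob_block by blast
  define C where "C = \<kappa> ^ 3 / (4 * \<sigma> * (\<sigma>\<^sup>2 + 1))"
  have C: "0 < C"
    using \<kappa>_pos \<sigma>_pos by (auto simp: C_def intro!: divide_pos_pos mult_pos_pos add_nonneg_pos)
  obtain q0 :: nat where q0: "((K + 1) / \<eta>)\<^sup>2 \<le> q0" using real_arch_simple by blast
  define q where "q = Suc q0"
  have q: "0 < q" "(K + 1) / \<eta> \<le> sqrt q"
    using q0 by (auto simp: q_def intro!: real_le_rsqrt)
  (* blocks have about \<theta> / e\<^sup>2 steps: e sqrt m \<le> 1 keeps the line below sqrt m on a block, and
     e sqrt n \<le> \<eta> holds for the initial stretch of n = q m steps *)
  define \<theta> where "\<theta> = min 1 (\<eta>\<^sup>2) / q"
  have "q * \<theta> = min 1 (\<eta>\<^sup>2)" using q by (simp add: \<theta>_def)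
  then have \<theta>: "0 < \<theta>" "\<theta> \<le> 1" "q * \<theta> \<le> \<eta>\<^sup>2"
    using \<eta>_pos q by (auto simp: \<theta>_def divide_le_eq min_le_iff_disj)
  define r where "r = nat \<lceil>2 * Y / \<theta>\<rceil>"
  have r: "2 * Y / \<theta> \<le> r" unfolding r_def by (rule real_nat_ceiling_ge)
  (* makes \<theta> / e\<^sup>2 at least m0 + 2, so that rounding down leaves at least half of it and at least m0 *)
  define e0 where "e0 = min 1 (sqrt (\<theta> / (real m0 + 2)))"
  have e0: "0 < e0" using \<theta> by (simp add: e0_def)
  have main: "c ^ r * C / \<eta> * e \<le> prob {\<omega>\<in>space M. alive e (nat \<lfloor>Y / e\<^sup>2\<rfloor>) \<omega>}"
    if e: "0 < e" "e \<le> e0" for e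
  proof -
    have e1: "e \<le> 1" using e by (simp add: e0_def)
    have "e\<^sup>2 \<le> (sqrt (\<theta> / (real m0 + 2)))\<^sup>2"
      using e by (intro power_mono) (auto simp: e0_def)
    also have "\<dots> = \<theta> / (real m0 + 2)" using \<theta> by simp
    finally have large: "real m0 + 2 \<le> \<theta> / e\<^sup>2"
      using e \<theta> by (simp add: field_simps)
    define m where "m = nat \<lfloor>\<theta> / e\<^sup>2\<rfloor>"
    have m: "real m \<le> \<theta> / e\<^sup>2" "\<theta> / e\<^sup>2 - 1 < real m"
    proof -
      have "0 \<le> \<theta> / e\<^sup>2" using \<theta> by simp
      then show "real m \<le> \<theta> / e\<^sup>2" "\<theta> / e\<^sup>2 - 1 < real m"
        unfolding m_def by linarith+
    qed
    then have mm0: "m0 \<le> m" "0 < m" and half: "\<theta> / (2 * e\<^sup>2) \<le> m" using large by auto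
    define n where "n = q * m"
    have em: "e\<^sup>2 * m \<le> \<theta>" using m e by (simp add: field_simps)
    have "e * sqrt m = sqrt (e\<^sup>2 * m)" using e by (simp add: real_sqrt_mult)
    also have "\<dots> \<le> 1" using em \<theta> by simp
    finally have "e * sqrt m * sqrt m \<le> 1 * sqrt m" by (intro mult_right_mono) auto
    then have slope: "e * m \<le> sqrt m" by (simp add: mult.assoc)
    have "e\<^sup>2 * n \<le> \<eta>\<^sup>2"
    proof -
      have "e\<^sup>2 * n = q * (e\<^sup>2 * m)" by (simp add: n_def)
      also have "\<dots> \<le> q * \<theta>" using em by (intro mult_left_mono) auto
      finally show ?thesis using \<theta> by simp
    qed
    then have "sqrt (e\<^sup>2 * n) \<le> \<eta>" using \<eta>_pos by (intro real_le_lsqrt) auto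
    then have en: "e * sqrt n \<le> \<eta>" using e by (simp add: real_sqrt_mult)
    have npos: "0 < n" using q mm0 by (simp add: n_def)
    have "(K + 1) * sqrt m = \<eta> * ((K + 1) / \<eta>) * sqrt m" using \<eta>_pos by simp
    also have "\<dots> \<le> \<eta> * sqrt q * sqrt m"
      using q \<eta>_pos by (intro mult_right_mono mult_left_mono) auto
    finally have h: "(K + 1) * sqrt m \<le> \<eta> * sqrt n" by (simp add: n_def real_sqrt_mult)
    have "e / \<eta> \<le> 1 / sqrt n" using en npos \<eta>_pos by (simp add: field_simps)
    then have "c ^ r * C * (e / \<eta>) \<le> c ^ r * C * (1 / sqrt n)"
      using c C by (intro mult_left_mono) auto
    then have "c ^ r * C / \<eta> * e \<le> C / sqrt n * c ^ r" by (simp add: mult.commute)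
    also have "\<dots> \<le> prob {\<omega>\<in>space M. alive e n \<omega> \<and> \<eta> * sqrt n \<le> height e n \<omega>} * c ^ r"
      using prob_alive_high[OF npos _ e1 en] e c by (intro mult_right_mono) (auto simp: C_def)
    also have "\<dots> \<le> prob {\<omega>\<in>space M. alive e (n + r * m) \<omega> \<and> \<eta> * sqrt n \<le> height e (n + r * m) \<omega>}"
      using prob_alive_append_blocks[OF slope _ h] blk mm0 e c by simp
    also have "\<dots> \<le> prob {\<omega>\<in>space M. alive e (nat \<lfloor>Y / e\<^sup>2\<rfloor>) \<omega>}"
    proof (rule finite_measure_mono)
      have "Y / e\<^sup>2 = 2 * Y / \<theta> * (\<theta> / (2 * e\<^sup>2))" using \<theta> by simp
      also have "\<dots> \<le> r * real m" using r half Y \<theta> by (intro mult_mono) auto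
      also have "\<dots> \<le> real (n + r * m)" by simp
      finally have "nat \<lfloor>Y / e\<^sup>2\<rfloor> \<le> n + r * m" by linarith
      then show "{\<omega>\<in>space M. alive e (n + r * m) \<omega> \<and> \<eta> * sqrt n \<le> height e (n + r * m) \<omega>}
        \<subseteq> {\<omega>\<in>space M. alive e (nat \<lfloor>Y / e\<^sup>2\<rfloor>) \<omega>}"
        using alive_mono by blast
    qed measurable
    finally show ?thesis .
  qed
  show ?thesis
    using main e0 c C \<eta>_pos by (intro exI[of _ "c ^ r * C / \<eta>"] exI[of _ e0] conjI) auto
qed

end

section \<open>Compound Poisson input\<close>

lemma nn_integral_poisson_pmf:
  assumes r: "0 < r" and f: "\<And>k. 0 \<le> f k" and s: "(\<lambda>k. f k * (r ^ k / fact k)) sums (c * exp r)"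
  shows "(\<integral>\<^sup>+k. ennreal (f k) \<partial>measure_pmf (poisson_pmf r)) = ennreal c"
proof -
  have "(\<integral>\<^sup>+k. ennreal (f k) \<partial>measure_pmf (poisson_pmf r))
    = (\<integral>\<^sup>+k. ennreal (f k * (r ^ k / fact k) * exp (- r)) \<partial>count_space UNIV)"
    by (subst nn_integral_measure_pmf)
       (use r f in \<open>auto intro!: nn_integral_cong simp: ac_simps simp flip: ennreal_mult'\<close>)
  also have "\<dots> = (\<Sum>k. ennreal (f k * (r ^ k / fact k) * exp (- r)))"
    by (rule nn_integral_count_space_nat)
  also have "\<dots> = ennreal (c * exp r * exp (- r))"
    using sums_mult2[OF s, of "exp (- r)"] f r
    by (subst suminf_ennreal_eq) auto
  also have "c * exp r * exp (- r) = c" by (simp add: exp_minus)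
  finally show ?thesis .
qed

lemma poisson_moments:
  assumes r: "0 < r"
  shows "(\<integral>\<^sup>+k. ennreal (real k) \<partial>measure_pmf (poisson_pmf r)) = ennreal r"
    and "(\<integral>\<^sup>+k. ennreal ((real k)\<^sup>2) \<partial>measure_pmf (poisson_pmf r)) = ennreal (r\<^sup>2 + r)"
proof -
  have e: "(\<lambda>k. r ^ k / fact k) sums exp r"
    using exp_converges[of r] by (simp add: divide_inverse_commute)
  have shift: "(\<lambda>k. real k * g k * (r ^ k / fact k)) sums (r * c)"
    if "(\<lambda>k. g (Suc k) * (r ^ k / fact k)) sums c" for g :: "nat \<Rightarrow> real" and c
  proof -
    have "(\<lambda>k. real (Suc k) * g (Suc k) * (r ^ Suc k / fact (Suc k)))
      = (\<lambda>k. r * (g (Suc k) * (r ^ k / fact k)))"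
      by (auto simp: fun_eq_iff simp del: of_nat_Suc)
    then have "(\<lambda>k. real (Suc k) * g (Suc k) * (r ^ Suc k / fact (Suc k))) sums (r * c)"
      using sums_mult[OF that, of r] by simp
    then show ?thesis
      using sums_Suc_iff[of "\<lambda>k. real k * g k * (r ^ k / fact k)" "r * c"] by simp
  qed
  have m1: "(\<lambda>k. real k * (r ^ k / fact k)) sums (r * exp r)"
    using shift[of "\<lambda>_. 1"] e by simp
  show "(\<integral>\<^sup>+k. ennreal (real k) \<partial>measure_pmf (poisson_pmf r)) = ennreal r"
    by (rule nn_integral_poisson_pmf[OF r _ m1]) simp
  have "(\<lambda>k. real (Suc k) * (r ^ k / fact k)) sums (r * exp r + exp r)"
    using sums_add[OF m1 e] by (simp add: field_simps)
  from shift[OF this] have m2: "(\<lambda>k. (real k)\<^sup>2 * (r ^ k / fact k)) sums ((r\<^sup>2 + r) * exp r)"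
    by (simp add: power2_eq_square algebra_simps)
  show "(\<integral>\<^sup>+k. ennreal ((real k)\<^sup>2) \<partial>measure_pmf (poisson_pmf r)) = ennreal (r\<^sup>2 + r)"
    by (rule nn_integral_poisson_pmf[OF r _ m2]) simp
qed

text \<open>Index set of the customers arriving in the \<open>k\<close>-th unit time interval, where \<open>c\<close> counts arrivals up to
  integer times. The customer present at time \<open>0\<close> forms a batch of its own, with index \<open>0\<close>, so that its
  independence of the input comes out of the same argument as the independence of the batches.\<close>
fun batch :: "(nat \<Rightarrow> nat) \<Rightarrow> nat \<Rightarrow> nat set" where
  "batch c 0 = {0}"
| "batch c (Suc k) = {c k<..c (Suc k)}"

lemma finite_batch: "finite (batch c j)"
  by (cases j) auto

lemma disjoint_batches:
  assumes "mono c"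
  shows "disjoint_family_on (batch c) J"
proof -
  have "batch c i \<inter> batch c j = {}" if ij: "i < j" for i j
  proof (cases i)
    case 0
    then show ?thesis using ij by (cases j) auto
  next
    case (Suc k)
    then obtain l where "j = Suc l" "Suc k \<le> l" using ij Suc by (cases j) auto
    then show ?thesis using monoD[OF assms, of "Suc k" l] Suc by auto
  qed
  then have "batch c i \<inter> batch c j = {}" if "i \<noteq> j" for i j
    using that by (metis Int_commute linorder_neqE_nat)
  then show ?thesis by (auto simp: disjoint_family_on_def)
qed

locale compound_poisson = iid_sequence M Bs for M :: "'a measure" and Bs +
  fixes r :: real and N :: "real \<Rightarrow> 'a \<Rightarrow> nat"
  assumes B_nonneg: "AE \<omega> in M. 0 \<le> Bs 0 \<omega>"
    and B_int: "integrable M (Bs 0)"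
    and B_sq: "integrable M (\<lambda>\<omega>. (Bs 0 \<omega>)\<^sup>2)"
    and poisson: "poisson_process M r N"
    and N_indep: "process_indep_of_seq M N Bs"
    and unit_load: "r * expectation (Bs 0) = 1"
begin

lemma r_pos: "0 < r"
  and N_measurable: "0 \<le> t \<Longrightarrow> N t \<in> measurable M (count_space UNIV)"
  and N_0: "\<omega> \<in> space M \<Longrightarrow> N 0 \<omega> = 0"
  and N_mono: "\<omega> \<in> space M \<Longrightarrow> 0 \<le> s \<Longrightarrow> s \<le> t \<Longrightarrow> N s \<omega> \<le> N t \<omega>"
  and N_right_cont: "\<omega> \<in> space M \<Longrightarrow> 0 \<le> t \<Longrightarrow> continuous (at_right t) (\<lambda>s. real (N s \<omega>))"
  and N_increment: "0 \<le> s \<Longrightarrow> s < t \<Longrightarrow>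
        distr M (count_space UNIV) (\<lambda>\<omega>. N t \<omega> - N s \<omega>) = measure_pmf (poisson_pmf (r * (t - s)))"
  and N_increments_indep: "0 \<le> u 0 \<Longrightarrow> (\<And>i. i < n \<Longrightarrow> u i \<le> u (Suc i)) \<Longrightarrow>
        indep_vars (\<lambda>_. count_space UNIV) (\<lambda>i \<omega>. N (u (Suc i)) \<omega> - N (u i) \<omega>) {..<n::nat}"
  using poisson unfolding poisson_process_def mono_on_def by auto

lemma measurable_N [measurable]: "N (real k) \<in> measurable M (count_space UNIV)"
  by (rule N_measurable) simp

lemma all_nonneg: "AE \<omega> in M. \<forall>i. 0 \<le> Bs i \<omega>"
proof -
  have "AE \<omega> in M. 0 \<le> Bs i \<omega>" for i
  proof -
    have "AE x in distr M borel (Bs 0). 0 \<le> x" using B_nonneg by (simp add: AE_distr_iff)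
    then have "AE x in distr M borel (Bs i). 0 \<le> x" unfolding ident[of i] .
    then show ?thesis by (simp add: AE_distr_iff)
  qed
  then show ?thesis by (simp add: AE_all_countable)
qed

text \<open>Only the arrival counts at integer times matter for the walk, so a path is a pair of
  sequences.\<close>
abbreviation counts :: "'a \<Rightarrow> nat \<Rightarrow> nat" where
  "counts \<omega> \<equiv> \<lambda>k. N (real k) \<omega>"

abbreviation "path_space \<equiv> (\<Pi>\<^sub>M k\<in>(UNIV::nat set). count_space (UNIV::nat set)) \<Otimes>\<^sub>M (\<Pi>\<^sub>M i\<in>(UNIV::nat set). (borel::real measure))"

text \<open>Fubini's theorem for the independent pair of arrival counts and service times: in computing an
  expectation, the counts may be frozen while the service times are averaged.\<close>
lemma nn_integral_freeze_counts:
  assumes f: "f \<in> borel_measurable path_space"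
  shows "(\<integral>\<^sup>+\<omega>. f (counts \<omega>, \<lambda>i. Bs i \<omega>) \<partial>M) = (\<integral>\<^sup>+\<omega>. \<integral>\<^sup>+\<omega>'. f (counts \<omega>, \<lambda>i. Bs i \<omega>') \<partial>M \<partial>M)"
proof -
  let ?P = "\<Pi>\<^sub>M k\<in>(UNIV::nat set). count_space (UNIV::nat set)"
  let ?Q = "\<Pi>\<^sub>M i\<in>(UNIV::nat set). (borel::real measure)"
  let ?c = counts and ?b = "\<lambda>\<omega> i. Bs i \<omega>"
  let ?SN = "vimage_algebra (space M) (\<lambda>\<omega>. \<lambda>t\<in>{0..}. N t \<omega>) (\<Pi>\<^sub>M t\<in>{0..}. count_space UNIV)"
  let ?SB = "vimage_algebra (space M) ?b ?Q"
  have c[measurable]: "?c \<in> measurable M ?P"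
    by (rule measurable_PiM_single') auto
  have b[measurable]: "?b \<in> measurable M ?Q"
    by (rule measurable_PiM_single') auto
  have cN: "?c \<in> measurable ?SN ?P"
  proof (rule measurable_PiM_single')
    fix k :: nat
    have "(\<lambda>\<omega>. \<lambda>t\<in>{0..}. N t \<omega>) \<in> measurable ?SN (\<Pi>\<^sub>M t\<in>{0..}. count_space UNIV)"
      by (rule measurable_vimage_algebra1) (auto simp: space_PiM)
    from measurable_compose[OF this measurable_component_singleton[of "real k"]]
    show "(\<lambda>\<omega>. N (real k) \<omega>) \<in> measurable ?SN (count_space UNIV)" by simp
  qed auto
  have bB: "?b \<in> measurable ?SB ?Q"
    by (rule measurable_vimage_algebra1) (auto simp: space_PiM)
  have indep: "indep_set (sets ?SN) (sets ?SB)"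
    using N_indep unfolding process_indep_of_seq_def .
  interpret C: prob_space "distr M ?P ?c" by (rule prob_space_distr) fact
  interpret B: prob_space "distr M ?Q ?b" by (rule prob_space_distr) fact
  have "distr M ?P ?c \<Otimes>\<^sub>M distr M ?Q ?b = distr M (?P \<Otimes>\<^sub>M ?Q) (\<lambda>\<omega>. (?c \<omega>, ?b \<omega>))"
  proof (rule pair_measure_eqI)
    show "sigma_finite_measure (distr M ?P ?c)" "sigma_finite_measure (distr M ?Q ?b)" ..
    fix U V assume "U \<in> sets (distr M ?P ?c)" "V \<in> sets (distr M ?Q ?b)"
    then have UV: "U \<in> sets ?P" "V \<in> sets ?Q" by auto
    have "?c -` U \<inter> space M \<in> sets ?SN" "?b -` V \<inter> space M \<in> sets ?SB"
      using measurable_sets[OF cN UV(1)] measurable_sets[OF bB UV(2)] by auto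
    with indep have "prob ((?c -` U \<inter> space M) \<inter> (?b -` V \<inter> space M))
        = prob (?c -` U \<inter> space M) * prob (?b -` V \<inter> space M)"
      unfolding indep_sets2_eq by blast
    moreover have "(\<lambda>\<omega>. (?c \<omega>, ?b \<omega>)) -` (U \<times> V) \<inter> space M
        = (?c -` U \<inter> space M) \<inter> (?b -` V \<inter> space M)" by auto
    ultimately show "emeasure (distr M ?P ?c) U * emeasure (distr M ?Q ?b) V
        = emeasure (distr M (?P \<Otimes>\<^sub>M ?Q) (\<lambda>\<omega>. (?c \<omega>, ?b \<omega>))) (U \<times> V)"
      using UV by (simp add: emeasure_distr emeasure_eq_measure ennreal_mult)
  qed simp
  then have "(\<integral>\<^sup>+\<omega>. f (?c \<omega>, ?b \<omega>) \<partial>M) = (\<integral>\<^sup>+z. f z \<partial>(distr M ?P ?c \<Otimes>\<^sub>M distr M ?Q ?b))"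
    using f by (simp add: nn_integral_distr)
  also have "\<dots> = (\<integral>\<^sup>+c. \<integral>\<^sup>+x. f (c, x) \<partial>distr M ?Q ?b \<partial>distr M ?P ?c)"
    by (rule B.nn_integral_fst[symmetric]) (use f in simp)
  also have "\<dots> = (\<integral>\<^sup>+\<omega>. \<integral>\<^sup>+x. f (?c \<omega>, x) \<partial>distr M ?Q ?b \<partial>M)"
    by (rule nn_integral_distr[OF c]) (use f in \<open>auto intro!: B.borel_measurable_nn_integral_fst\<close>)
  also have "\<dots> = (\<integral>\<^sup>+\<omega>. \<integral>\<^sup>+\<omega>'. f (?c \<omega>, ?b \<omega>') \<partial>M \<partial>M)"
    by (intro nn_integral_cong nn_integral_distr[OF b] measurable_compose[OF _ f])
       (auto simp: space_PiM)
  finally show ?thesis .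
qed

lemma mono_counts: "\<omega> \<in> space M \<Longrightarrow> mono (counts \<omega>)"
  by (auto simp: mono_def intro: N_mono)

definition batch_sum :: "nat \<Rightarrow> 'a \<Rightarrow> real" where
  "batch_sum j \<omega> = (\<Sum>i\<in>batch (counts \<omega>) j. Bs i \<omega>)"

lemma measurable_batch_path [measurable]:
  "(\<lambda>(c, x). \<Sum>i\<in>batch c j. x i) \<in> borel_measurable path_space"
proof (cases j)
  case 0
  then show ?thesis by simp
next
  case (Suc k)
  have [measurable]: "(\<lambda>z. fst z l) \<in> measurable path_space (count_space UNIV)" for l
    by (rule measurable_compose[OF measurable_fst measurable_component_singleton]) simp
  have [measurable]: "(\<lambda>z. snd z l) \<in> borel_measurable path_space" for l
    by (rule measurable_compose[OF measurable_snd measurable_component_singleton]) simp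
  have "(\<lambda>z. \<Sum>i\<in>{fst z k<..fst z (Suc k)}. snd z i) \<in> borel_measurable path_space"
  proof (rule measurable_compose_countable[where g = "\<lambda>z. fst z k" and f = "\<lambda>l z. \<Sum>i\<in>{l<..fst z (Suc k)}. snd z i"])
    fix l :: nat
    show "(\<lambda>z. \<Sum>i\<in>{l<..fst z (Suc k)}. snd z i) \<in> borel_measurable path_space"
      by (rule measurable_compose_countable[where g = "\<lambda>z. fst z (Suc k)" and f = "\<lambda>u z. \<Sum>i\<in>{l<..u}. snd z i"]) measurable
  qed measurable
  then show ?thesis by (simp add: Suc case_prod_beta')
qed

lemma measurable_paths: "(\<lambda>\<omega>. (counts \<omega>, \<lambda>i. Bs i \<omega>)) \<in> measurable M path_space"
  by (intro measurable_Pair measurable_PiM_single') auto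

lemma measurable_batch_sum [measurable]: "batch_sum j \<in> borel_measurable M"
  using measurable_compose[OF measurable_paths measurable_batch_path]
  by (simp add: batch_sum_def[abs_def])

definition size_of_batch :: "nat \<Rightarrow> 'a \<Rightarrow> nat" where
  "size_of_batch j \<omega> = card (batch (counts \<omega>) j)"

lemma size_of_batch_simps [simp]:
  "size_of_batch 0 \<omega> = 1"
  "size_of_batch (Suc k) \<omega> = N (real (Suc k)) \<omega> - N (real k) \<omega>"
  by (simp_all add: size_of_batch_def)

lemma measurable_size_of_batch [measurable]: "size_of_batch j \<in> measurable M (count_space UNIV)"
proof -
  have "size_of_batch j = (\<lambda>\<omega>. if j = 0 then 1 else N (real j) \<omega> - N (real (j - 1)) \<omega>)"
    by (cases j) auto
  then show ?thesis by simp
qed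

definition sum_law :: "real set \<Rightarrow> nat \<Rightarrow> ennreal" where
  "sum_law A d = emeasure M {\<omega>\<in>space M. (\<Sum>i<d. Bs i \<omega>) \<in> A}"

text \<open>With the counts frozen, the batches are fixed disjoint index sets. The batch sums are then
  independent, and the law of each depends only on the size of its batch.\<close>
lemma emeasure_batch_sums:
  assumes J: "finite J" and A: "\<And>j. j \<in> J \<Longrightarrow> A j \<in> sets borel"
  shows "emeasure M {\<omega>\<in>space M. \<forall>j\<in>J. batch_sum j \<omega> \<in> A j}
    = (\<integral>\<^sup>+\<omega>. (\<Prod>j\<in>J. sum_law (A j) (size_of_batch j \<omega>)) \<partial>M)"
proof (cases "J = {}")
  case True
  then show ?thesis by (simp add: emeasure_space_1)
next
  case ne: False
  let ?f = "\<lambda>(c, x). indicator {z. \<forall>j\<in>J. (\<Sum>i\<in>batch (fst z) j. snd z i) \<in> A j} (c, x) :: ennreal"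
  have meas: "(\<lambda>z. \<Sum>i\<in>batch (fst z) j. snd z i) \<in> borel_measurable path_space" for j
    using measurable_batch_path[of j] by (simp add: case_prod_beta')
  have "{z\<in>space path_space. \<forall>j\<in>J. (\<Sum>i\<in>batch (fst z) j. snd z i) \<in> A j} \<in> sets path_space"
    by (intro sets.sets_Collect_finite_All' measurable_sets_Collect[OF meas]) (use J ne A in auto)
  then have f: "?f \<in> borel_measurable path_space"
    by (simp add: case_prod_beta' space_pair_measure space_PiM)
  have sets1: "{\<omega>\<in>space M. \<forall>j\<in>J. batch_sum j \<omega> \<in> A j} \<in> sets M"
    by (intro sets.sets_Collect_finite_All' measurable_sets_Collect[OF measurable_batch_sum])
       (use J ne A in auto)
  have "emeasure M {\<omega>\<in>space M. \<forall>j\<in>J. batch_sum j \<omega> \<in> A j} = (\<integral>\<^sup>+\<omega>. ?f (counts \<omega>, \<lambda>i. Bs i \<omega>) \<partial>M)"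
    unfolding nn_integral_indicator[OF sets1, symmetric]
    by (intro nn_integral_cong) (auto simp: indicator_def batch_sum_def)
  also have "\<dots> = (\<integral>\<^sup>+\<omega>. \<integral>\<^sup>+\<omega>'. ?f (counts \<omega>, \<lambda>i. Bs i \<omega>') \<partial>M \<partial>M)"
    by (rule nn_integral_freeze_counts[OF f])
  also have "\<dots> = (\<integral>\<^sup>+\<omega>. (\<Prod>j\<in>J. sum_law (A j) (size_of_batch j \<omega>)) \<partial>M)"
  proof (rule nn_integral_cong)
    fix \<omega> assume \<omega>: "\<omega> \<in> space M"
    let ?c = "counts \<omega>"
    have ind: "indep_vars (\<lambda>_. borel) (\<lambda>j \<omega>'. \<Sum>i\<in>batch ?c j. Bs i \<omega>') J"
    proof -
      have "indep_vars (\<lambda>j. PiM (batch ?c j) (\<lambda>_. borel)) (\<lambda>j \<omega>. \<lambda>i\<in>batch ?c j. Bs i \<omega>) J"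
        by (rule indep_vars_restrict[OF indep]) (auto intro: disjoint_batches mono_counts \<omega>)
      then have "indep_vars (\<lambda>_. borel) (\<lambda>j \<omega>. (\<lambda>x. \<Sum>i\<in>batch ?c j. x i) (\<lambda>i\<in>batch ?c j. Bs i \<omega>)) J"
        by (rule indep_vars_compose2) (auto intro!: borel_measurable_sum measurable_component_singleton)
      then show ?thesis by simp
    qed
    let ?E = "\<lambda>j. {\<omega>'\<in>space M. (\<Sum>i\<in>batch ?c j. Bs i \<omega>') \<in> A j}"
    have E: "?E j \<in> sets M" if "j \<in> J" for j
      using A[OF that] by measurable
    have eq: "(\<Inter>j\<in>J. ?E j) = {\<omega>'\<in>space M. \<forall>j\<in>J. (\<Sum>i\<in>batch ?c j. Bs i \<omega>') \<in> A j}"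
      using ne by auto
    have eq': "(\<lambda>\<omega>'. \<Sum>i\<in>batch ?c j. Bs i \<omega>') -` A j \<inter> space M = ?E j" for j by auto
    have "(\<integral>\<^sup>+\<omega>'. ?f (?c, \<lambda>i. Bs i \<omega>') \<partial>M) = emeasure M {\<omega>'\<in>space M. \<forall>j\<in>J. \<omega>' \<in> ?E j}"
      by (subst nn_integral_indicator[symmetric])
         (use E J ne in \<open>auto intro!: nn_integral_cong sets.sets_Collect_finite_All' simp: indicator_def simp del: nn_integral_indicator\<close>)
    also have "\<dots> = ennreal (prob {\<omega>'\<in>space M. \<forall>j\<in>J. (\<Sum>i\<in>batch ?c j. Bs i \<omega>') \<in> A j})"
      by (auto simp: emeasure_eq_measure intro!: arg_cong[of _ _ prob])
    also have "\<dots> = ennreal (\<Prod>j\<in>J. prob (?E j))"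
      using indep_varsD_finite[of "\<lambda>_. borel" "\<lambda>j \<omega>'. \<Sum>i\<in>batch ?c j. Bs i \<omega>'" J A, OF ind ne J] A
      unfolding eq' eq by simp
    also have "\<dots> = (\<Prod>j\<in>J. sum_law (A j) (size_of_batch j \<omega>))"
      using A by (simp add: sum_law_def size_of_batch_def emeasure_eq_measure prod_ennreal
        prob_sum_card[OF finite_batch, symmetric])
    finally show "(\<integral>\<^sup>+\<omega>'. ?f (?c, \<lambda>i. Bs i \<omega>') \<partial>M) = (\<Prod>j\<in>J. sum_law (A j) (size_of_batch j \<omega>))" .
  qed
  finally show ?thesis .
qed

text \<open>The subtraction is truncated, so index \<open>0\<close> carries the trivial increment over the empty interval
  from \<open>0\<close> to \<open>0\<close>. This aligns the increments of the process with the numbering of the batches.\<close>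
lemma indep_batch_sizes: "indep_vars (\<lambda>_. count_space UNIV) (\<lambda>j \<omega>. N (real j) \<omega> - N (real (j - 1)) \<omega>) {..<n}"
  using N_increments_indep[of "\<lambda>j. real (j - 1)" n] by simp

text \<open>Each factor in the formula of \<open>emeasure_batch_sums\<close> is a function of one batch size, and the
  batch sizes are independent, so the expectation of the product factorises.\<close>
lemma indep_batch_sums: "indep_vars (\<lambda>_. borel) batch_sum UNIV"
proof -
  have prod: "emeasure M {\<omega>\<in>space M. \<forall>j\<in>J. batch_sum j \<omega> \<in> A j}
      = (\<Prod>j\<in>J. emeasure M {\<omega>\<in>space M. batch_sum j \<omega> \<in> A j})"
    if J: "finite J" and A: "\<And>j. j \<in> J \<Longrightarrow> A j \<in> sets borel" for J A
  proof -
    obtain n where n: "J \<subseteq> {..<n}" using J finite_nat_iff_bounded by blast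
    have "indep_vars (\<lambda>_. borel)
        (\<lambda>j \<omega>. (\<lambda>d. sum_law (A j) (if j = 0 then 1 else d)) (N (real j) \<omega> - N (real (j - 1)) \<omega>)) J"
      by (rule indep_vars_compose2[OF indep_vars_subset[OF indep_batch_sizes n]]) simp
    also have "(\<lambda>j \<omega>. (\<lambda>d. sum_law (A j) (if j = 0 then 1 else d)) (N (real j) \<omega> - N (real (j - 1)) \<omega>))
       = (\<lambda>j \<omega>. sum_law (A j) (size_of_batch j \<omega>))"
    proof (intro ext)
      fix j \<omega> show "(\<lambda>d. sum_law (A j) (if j = 0 then 1 else d)) (N (real j) \<omega> - N (real (j - 1)) \<omega>)
        = sum_law (A j) (size_of_batch j \<omega>)" by (cases j) simp_all
    qed
    finally have ind: "indep_vars (\<lambda>_. borel) (\<lambda>j \<omega>. sum_law (A j) (size_of_batch j \<omega>)) J" .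
    have "emeasure M {\<omega>\<in>space M. \<forall>j\<in>J. batch_sum j \<omega> \<in> A j}
      = (\<Prod>j\<in>J. \<integral>\<^sup>+\<omega>. sum_law (A j) (size_of_batch j \<omega>) \<partial>M)"
      using emeasure_batch_sums[OF J A] indep_vars_nn_integral[OF J ind] by simp
    also have "\<dots> = (\<Prod>j\<in>J. emeasure M {\<omega>\<in>space M. batch_sum j \<omega> \<in> A j})"
    proof (rule prod.cong)
      fix j assume "j \<in> J"
      then show "(\<integral>\<^sup>+\<omega>. sum_law (A j) (size_of_batch j \<omega>) \<partial>M) = emeasure M {\<omega>\<in>space M. batch_sum j \<omega> \<in> A j}"
        using emeasure_batch_sums[of "{j}" A] A by simp
    qed simp
    finally show ?thesis .
  qed
  show ?thesis
    unfolding indep_vars_def2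
  proof (intro conjI ballI indep_setsI)
    fix j show "batch_sum j \<in> borel_measurable M" by measurable
    then show "{batch_sum j -` A \<inter> space M |A. A \<in> sets borel} \<subseteq> events" by auto
  next
    fix F J assume J: "J \<noteq> {}" "finite J" and "\<forall>j\<in>J. F j \<in> {batch_sum j -` A \<inter> space M |A. A \<in> sets borel}"
    then have "\<forall>j\<in>J. \<exists>A. A \<in> sets borel \<and> F j = batch_sum j -` A \<inter> space M" by blast
    then obtain A where A: "\<And>j. j \<in> J \<Longrightarrow> A j \<in> sets borel"
      and F: "\<And>j. j \<in> J \<Longrightarrow> F j = batch_sum j -` A j \<inter> space M"
      using bchoice[of J "\<lambda>j A. A \<in> sets borel \<and> F j = batch_sum j -` A \<inter> space M"] by blast
    have "F j = {\<omega>\<in>space M. batch_sum j \<omega> \<in> A j}" if "j \<in> J" for j using F[OF that] by auto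
    moreover have "(\<Inter>j\<in>J. F j) = {\<omega>\<in>space M. \<forall>j\<in>J. batch_sum j \<omega> \<in> A j}"
      using F J by auto
    ultimately have "ennreal (prob (\<Inter>j\<in>J. F j)) = ennreal (\<Prod>j\<in>J. prob (F j))"
      using prod[OF J(2) A] by (simp add: emeasure_eq_measure prod_ennreal)
    then show "prob (\<Inter>j\<in>J. F j) = (\<Prod>j\<in>J. prob (F j))"
      by (simp add: prod_nonneg)
  qed
qed

lemma nn_integral_batch_size:
  "(\<integral>\<^sup>+\<omega>. f (size_of_batch (Suc k) \<omega>) \<partial>M) = (\<integral>\<^sup>+d. f d \<partial>measure_pmf (poisson_pmf r))"
proof -
  have "(\<lambda>\<omega>. N (real (Suc k)) \<omega> - N (real k) \<omega>) \<in> measurable M (count_space UNIV)"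
    by measurable
  then have "(\<integral>\<^sup>+\<omega>. f (size_of_batch (Suc k) \<omega>) \<partial>M)
     = (\<integral>\<^sup>+d. f d \<partial>distr M (count_space UNIV) (\<lambda>\<omega>. N (real (Suc k)) \<omega> - N (real k) \<omega>))"
    by (subst nn_integral_distr) (auto simp del: of_nat_Suc)
  also have "\<dots> = (\<integral>\<^sup>+d. f d \<partial>measure_pmf (poisson_pmf r))"
    by (subst N_increment) auto
  finally show ?thesis .
qed

lemma batch_sum_ident: "distr M borel (batch_sum (Suc k)) = distr M borel (batch_sum (Suc 0))"
proof (rule measure_eqI)
  have moment_ident: "emeasure (distr M borel (batch_sum (Suc k))) A = (\<integral>\<^sup>+d. sum_law A d \<partial>measure_pmf (poisson_pmf r))"
    if A: "A \<in> sets borel" for A k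
  proof -
    have "emeasure (distr M borel (batch_sum (Suc k))) A = emeasure M {\<omega>\<in>space M. batch_sum (Suc k) \<omega> \<in> A}"
      by (subst emeasure_distr) (use A in \<open>auto intro!: arg_cong[of _ _ "emeasure M"]\<close>)
    also have "\<dots> = (\<integral>\<^sup>+\<omega>. sum_law A (size_of_batch (Suc k) \<omega>) \<partial>M)"
      using emeasure_batch_sums[of "{Suc k}" "\<lambda>_. A"] A by simp
    finally show ?thesis by (simp only: nn_integral_batch_size)
  qed
  fix A assume "A \<in> sets (distr M borel (batch_sum (Suc k)))"
  then show "emeasure (distr M borel (batch_sum (Suc k))) A = emeasure (distr M borel (batch_sum (Suc 0))) A"
    using moment_ident by simp
qed simp

lemma Bs_moments:
  "integrable M (Bs i)" "expectation (Bs i) = expectation (Bs 0)"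
  "integrable M (\<lambda>\<omega>. (Bs i \<omega>)\<^sup>2)" "expectation (\<lambda>\<omega>. (Bs i \<omega>)\<^sup>2) = expectation (\<lambda>\<omega>. (Bs 0 \<omega>)\<^sup>2)"
  using moment_ident[of "\<lambda>x. x" i] moment_ident[of "\<lambda>x. x\<^sup>2" i] B_int B_sq by auto

lemma batch_sum_nonneg: "AE \<omega> in M. 0 \<le> batch_sum j \<omega>"
  using all_nonneg by eventually_elim (auto simp: batch_sum_def intro!: sum_nonneg)

lemma nn_integral_batch_sum: "(\<integral>\<^sup>+\<omega>. ennreal (batch_sum (Suc k) \<omega>) \<partial>M) = 1"
proof -
  have [measurable]: "(\<lambda>z. \<Sum>i\<in>batch (fst z) j. snd z i) \<in> borel_measurable path_space" for j
    using measurable_batch_path[of j] by (simp add: case_prod_beta')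
  have "(\<integral>\<^sup>+\<omega>. ennreal (batch_sum (Suc k) \<omega>) \<partial>M)
     = (\<integral>\<^sup>+\<omega>. \<integral>\<^sup>+\<omega>'. ennreal (\<Sum>i\<in>batch (counts \<omega>) (Suc k). Bs i \<omega>') \<partial>M \<partial>M)"
    using nn_integral_freeze_counts[of "\<lambda>z. ennreal (\<Sum>i\<in>batch (fst z) (Suc k). snd z i)"]
    by (simp add: batch_sum_def del: batch.simps)
  also have "\<dots> = (\<integral>\<^sup>+\<omega>. ennreal (expectation (Bs 0)) * ennreal (real (size_of_batch (Suc k) \<omega>)) \<partial>M)"
  proof (rule nn_integral_cong)
    fix \<omega>
    let ?S = "batch (counts \<omega>) (Suc k)"
    have "(\<integral>\<^sup>+\<omega>'. ennreal (\<Sum>i\<in>?S. Bs i \<omega>') \<partial>M) = ennreal (expectation (\<lambda>\<omega>'. \<Sum>i\<in>?S. Bs i \<omega>'))"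
    proof (rule nn_integral_eq_integral)
      show "integrable M (\<lambda>\<omega>'. \<Sum>i\<in>?S. Bs i \<omega>')" using Bs_moments(1) by auto
      show "AE \<omega>' in M. 0 \<le> (\<Sum>i\<in>?S. Bs i \<omega>')"
        using all_nonneg by eventually_elim (auto intro!: sum_nonneg)
    qed
    also have "expectation (\<lambda>\<omega>'. \<Sum>i\<in>?S. Bs i \<omega>') = expectation (Bs 0) * real (size_of_batch (Suc k) \<omega>)"
    proof -
      have "expectation (\<lambda>\<omega>'. \<Sum>i\<in>?S. Bs i \<omega>') = (\<Sum>i\<in>?S. expectation (Bs i))"
        by (rule Bochner_Integration.integral_sum) (rule Bs_moments(1))
      also have "\<dots> = (\<Sum>i\<in>?S. expectation (Bs 0))"
        by (rule sum.cong[OF refl Bs_moments(2)])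
      finally show ?thesis by (simp add: size_of_batch_def del: batch.simps)
    qed
    finally show "(\<integral>\<^sup>+\<omega>'. ennreal (\<Sum>i\<in>?S. Bs i \<omega>') \<partial>M)
        = ennreal (expectation (Bs 0)) * ennreal (real (size_of_batch (Suc k) \<omega>))"
      by (simp add: ennreal_mult'')
  qed
  also have "\<dots> = ennreal (expectation (Bs 0)) * ennreal r"
    using nn_integral_batch_size[of "\<lambda>d. ennreal (real d)" k] poisson_moments(1)[OF r_pos]
    by (simp add: nn_integral_cmult del: size_of_batch_simps)
  also have "\<dots> = 1"
    using unit_load r_pos by (subst ennreal_mult''[symmetric]) (auto simp: mult.commute)
  finally show ?thesis .
qed

text \<open>For a frozen batch of size \<open>d\<close> the squared sum has expectation at most \<open>d\<^sup>2 E[B\<^sup>2]\<close>, and the Poisson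
  distribution has a finite second moment.\<close>
lemma batch_sum_sq: "integrable M (\<lambda>\<omega>. (batch_sum (Suc k) \<omega>)\<^sup>2)"
proof (rule integrableI_bounded)
  have [measurable]: "(\<lambda>z. \<Sum>i\<in>batch (fst z) j. snd z i) \<in> borel_measurable path_space" for j
    using measurable_batch_path[of j] by (simp add: case_prod_beta')
  let ?v = "expectation (\<lambda>\<omega>. (Bs 0 \<omega>)\<^sup>2)"
  have "(\<integral>\<^sup>+\<omega>. ennreal ((batch_sum (Suc k) \<omega>)\<^sup>2) \<partial>M)
     = (\<integral>\<^sup>+\<omega>. \<integral>\<^sup>+\<omega>'. ennreal ((\<Sum>i\<in>batch (counts \<omega>) (Suc k). Bs i \<omega>')\<^sup>2) \<partial>M \<partial>M)"
    using nn_integral_freeze_counts[of "\<lambda>z. ennreal ((\<Sum>i\<in>batch (fst z) (Suc k). snd z i)\<^sup>2)"]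
    by (simp add: batch_sum_def del: batch.simps)
  also have "\<dots> \<le> (\<integral>\<^sup>+\<omega>. ennreal ?v * ennreal ((real (size_of_batch (Suc k) \<omega>))\<^sup>2) \<partial>M)"
  proof (rule nn_integral_mono)
    fix \<omega>
    let ?S = "batch (counts \<omega>) (Suc k)"
    have "(\<integral>\<^sup>+\<omega>'. ennreal ((\<Sum>i\<in>?S. Bs i \<omega>')\<^sup>2) \<partial>M)
        \<le> (\<integral>\<^sup>+\<omega>'. ennreal (real (card ?S) * (\<Sum>i\<in>?S. (Bs i \<omega>')\<^sup>2)) \<partial>M)"
      by (intro nn_integral_mono ennreal_leI)
         (use sum_squared_le_sum_of_squares[of "\<lambda>i. Bs i _" ?S] in \<open>simp add: mult.commute del: batch.simps\<close>)
    also have "\<dots> = ennreal (expectation (\<lambda>\<omega>'. real (card ?S) * (\<Sum>i\<in>?S. (Bs i \<omega>')\<^sup>2)))"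
      by (rule nn_integral_eq_integral) (use Bs_moments(3) in \<open>auto intro!: mult_nonneg_nonneg sum_nonneg\<close>)
    also have "expectation (\<lambda>\<omega>'. real (card ?S) * (\<Sum>i\<in>?S. (Bs i \<omega>')\<^sup>2)) = ?v * (real (size_of_batch (Suc k) \<omega>))\<^sup>2"
    proof -
      have "expectation (\<lambda>\<omega>'. \<Sum>i\<in>?S. (Bs i \<omega>')\<^sup>2) = (\<Sum>i\<in>?S. expectation (\<lambda>\<omega>'. (Bs i \<omega>')\<^sup>2))"
        by (rule Bochner_Integration.integral_sum) (rule Bs_moments(3))
      also have "\<dots> = (\<Sum>i\<in>?S. ?v)"
        by (rule sum.cong[OF refl Bs_moments(4)])
      finally show ?thesis
        by (simp add: size_of_batch_def power2_eq_square del: batch.simps)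
    qed
    finally show "(\<integral>\<^sup>+\<omega>'. ennreal ((\<Sum>i\<in>?S. Bs i \<omega>')\<^sup>2) \<partial>M)
        \<le> ennreal ?v * ennreal ((real (size_of_batch (Suc k) \<omega>))\<^sup>2)"
      by (simp add: ennreal_mult'')
  qed
  also have "\<dots> = ennreal ?v * ennreal (r\<^sup>2 + r)"
    using nn_integral_batch_size[of "\<lambda>d. ennreal ((real d)\<^sup>2)" k] poisson_moments(2)[OF r_pos]
    by (simp add: nn_integral_cmult del: size_of_batch_simps)
  also have "\<dots> < \<infinity>" by (simp add: ennreal_mult_less_top)
  finally show "(\<integral>\<^sup>+\<omega>. ennreal (norm ((batch_sum (Suc k) \<omega>)\<^sup>2)) \<partial>M) < \<infinity>" by simp
qed measurable

lemma batch_sum_mean: "integrable M (batch_sum (Suc k))" "expectation (batch_sum (Suc k)) = 1"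
proof -
  show int: "integrable M (batch_sum (Suc k))"
    using square_integrable_imp_integrable[OF _ batch_sum_sq] by simp
  have "ennreal (expectation (batch_sum (Suc k))) = 1"
    using nn_integral_eq_integral[OF int batch_sum_nonneg] nn_integral_batch_sum[of k] by simp
  then show "expectation (batch_sum (Suc k)) = 1"
    using integral_nonneg_AE[OF batch_sum_nonneg[of "Suc k"]] by (simp add: ennreal_eq_1)
qed

text \<open>This makes the steps of the walk nondegenerate: a batch that may be empty cannot have a
  constant sum equal to its mean \<open>1\<close>.\<close>
lemma prob_no_arrival: "0 < prob {\<omega>\<in>space M. N 1 \<omega> = 0}"
proof -
  have "prob {\<omega>\<in>space M. N 1 \<omega> = 0} = measure (distr M (count_space UNIV) (\<lambda>\<omega>. N 1 \<omega> - N 0 \<omega>)) {0}"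
    using N_measurable[of 0] N_measurable[of 1]
    by (subst measure_distr) (auto simp: N_0 intro!: arg_cong[of _ _ prob])
  also have "\<dots> = exp (- r)"
    using r_pos by (subst N_increment) (auto simp: measure_pmf_single)
  finally show ?thesis by simp
qed

lemma centered_batch_walk:
  "\<exists>\<sigma>. centered_walk M (\<lambda>k \<omega>. batch_sum (Suc k) \<omega> - 1) \<sigma>"
proof -
  let ?\<xi> = "\<lambda>k \<omega>. batch_sum (Suc k) \<omega> - 1"
  define v where "v = expectation (\<lambda>\<omega>. (?\<xi> 0 \<omega>)\<^sup>2)"
  have sq: "integrable M (\<lambda>\<omega>. (?\<xi> 0 \<omega>)\<^sup>2)"
    using batch_sum_sq[of 0] batch_sum_mean(1)[of 0] by (simp add: power2_diff)
  have ind: "indep_vars (\<lambda>_. borel) ?\<xi> UNIV"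
  proof -
    have "indep_vars (\<lambda>j. PiM {Suc j} (\<lambda>_. borel)) (\<lambda>j \<omega>. \<lambda>i\<in>{Suc j}. batch_sum i \<omega>) UNIV"
      by (rule indep_vars_restrict[OF indep_batch_sums]) (auto simp: disjoint_family_on_def)
    then have "indep_vars (\<lambda>_. borel) (\<lambda>j \<omega>. (\<lambda>x. x (Suc j) - 1) (\<lambda>i\<in>{Suc j}. batch_sum i \<omega>)) UNIV"
      by (rule indep_vars_compose2) auto
    then show ?thesis by simp
  qed
  have "0 \<le> v" unfolding v_def by (rule Bochner_Integration.integral_nonneg) auto
  moreover have "v \<noteq> 0"
  proof
    assume "v = 0"
    then have "AE \<omega> in M. (?\<xi> 0 \<omega>)\<^sup>2 = 0"
      using integral_nonneg_eq_0_iff_AE[OF sq] unfolding v_def by auto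
    then have "AE \<omega> in M. \<not> (N 1 \<omega> = 0)"
    proof eventually_elim
      case (elim \<omega>)
      then show ?case by (cases "N 1 \<omega> = 0") (simp_all add: batch_sum_def)
    qed
    then have "prob {\<omega>\<in>space M. N 1 \<omega> = 0} = 0"
      using N_measurable[of 1] by (subst prob_eq_0) auto
    then show False using prob_no_arrival by simp
  qed
  ultimately have v: "0 < v" by simp
  have "centered_walk M ?\<xi> (sqrt v)"
  proof
    show "indep_vars (\<lambda>_. borel) ?\<xi> UNIV" by (rule ind)
    show "distr M borel (?\<xi> i) = distr M borel (?\<xi> 0)" for i
    proof -
      have "distr M borel (?\<xi> i) = distr (distr M borel (batch_sum (Suc i))) borel (\<lambda>x. x - 1)" for i
        by (subst distr_distr) (auto simp: comp_def)
      then show ?thesis using batch_sum_ident[of i] by simp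
    qed
    show "expectation (?\<xi> 0) = 0" using batch_sum_mean[of 0] by (simp add: prob_space)
  qed (use sq v in \<open>auto simp: v_def\<close>)
  then show ?thesis by blast
qed

end

section \<open>Hitting time of the workload\<close>

text \<open>\<open>x\<^sup>2 P(Z > x)\<close> is at most the part of the second moment carried by \<open>Z > x\<close>, which vanishes by
  dominated convergence.\<close>
lemma (in prob_space) second_moment_tail:
  fixes Z :: "'a \<Rightarrow> real"
  assumes [measurable]: "Z \<in> borel_measurable M" and sq: "integrable M (\<lambda>\<omega>. (Z \<omega>)\<^sup>2)"
  shows "((\<lambda>x. x\<^sup>2 * prob {\<omega>\<in>space M. x < Z \<omega>}) \<longlongrightarrow> 0) at_top"
proof (rule tendsto_sandwich)
  let ?f = "\<lambda>x \<omega>. (Z \<omega>)\<^sup>2 * of_bool (x < Z \<omega>)"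
  have int: "integrable M (?f x)" for x
    by (rule integrable_mult_of_bool[OF sq]) measurable
  show "eventually (\<lambda>x. 0 \<le> x\<^sup>2 * prob {\<omega>\<in>space M. x < Z \<omega>}) at_top" by simp
  show "eventually (\<lambda>x. x\<^sup>2 * prob {\<omega>\<in>space M. x < Z \<omega>} \<le> expectation (?f x)) at_top"
    using eventually_ge_at_top[of 0]
  proof eventually_elim
    case (elim x)
    have int': "integrable M (\<lambda>\<omega>. x\<^sup>2 * of_bool (x < Z \<omega>))"
      by (intro integrable_mult_right expectation_of_bool(1)) measurable
    have "x\<^sup>2 * prob {\<omega>\<in>space M. x < Z \<omega>} = expectation (\<lambda>\<omega>. x\<^sup>2 * of_bool (x < Z \<omega>))"
      by (simp add: expectation_of_bool)
    also have "\<dots> \<le> expectation (?f x)"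
      using elim by (intro integral_mono[OF int' int]) (auto intro: power_mono)
    finally show ?case .
  qed
  have "((\<lambda>x. expectation (?f x)) \<longlongrightarrow> expectation (\<lambda>_. 0)) at_top"
  proof (rule integral_dominated_convergence_at_top[where w="\<lambda>\<omega>. (Z \<omega>)\<^sup>2"])
    show "AE \<omega> in M. ((\<lambda>x. ?f x \<omega>) \<longlongrightarrow> 0) at_top"
    proof (rule AE_I2)
      fix \<omega>
      have "eventually (\<lambda>x. ?f x \<omega> = 0) at_top"
        using eventually_ge_at_top[of "Z \<omega>"] by eventually_elim auto
      then show "((\<lambda>x. ?f x \<omega>) \<longlongrightarrow> 0) at_top" by (rule tendsto_eventually)
    qed
  qed (use sq in \<open>auto simp: of_bool_def\<close>)
  then show "((\<lambda>x. expectation (?f x)) \<longlongrightarrow> 0) at_top" by simp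
qed simp

context compound_poisson begin

text \<open>Let \<open>k\<close> be the integer part of \<open>\<rho> t\<close>. At least the input of the first \<open>k\<close> unit intervals has
  arrived, which is at least \<open>(1 + e) k\<close>, while \<open>t < (1 + e) (k + 1)\<close>. The difference of at most
  \<open>1 + e \<le> 2\<close> is covered by the initial workload.\<close>
lemma workload_pos:
  assumes \<omega>: "\<omega> \<in> space M" and nonneg: "\<forall>i. 0 \<le> Bs i \<omega>" and first: "2 < Bs 0 \<omega>"
    and \<rho>: "0 < \<rho>" and e: "e = 1 / \<rho> - 1" "0 \<le> e" "e \<le> 1"
    and above: "\<forall>k\<in>{1..n}. e * real k < (\<Sum>i=1..N (real k) \<omega>. Bs i \<omega>) - k"
    and t: "0 \<le> t" "\<rho> * t < real n + 1"
  shows "0 < workload Bs N \<rho> t \<omega>"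
proof -
  define k where "k = nat \<lfloor>\<rho> * t\<rfloor>"
  have "0 \<le> \<rho> * t" using \<rho> t by simp
  then have k: "real k \<le> \<rho> * t" "\<rho> * t < real k + 1" unfolding k_def by linarith+
  then have "k \<le> n" using t by linarith
  have "N (real k) \<omega> \<le> N (\<rho> * t) \<omega>" using k \<omega> by (intro N_mono) auto
  then have "(\<Sum>i=1..N (real k) \<omega>. Bs i \<omega>) \<le> (\<Sum>i=1..N (\<rho> * t) \<omega>. Bs i \<omega>)"
    using nonneg by (intro sum_mono2) auto
  moreover have "(1 + e) * k \<le> (\<Sum>i=1..N (real k) \<omega>. Bs i \<omega>)"
  proof (cases "k = 0")
    case True
    then show ?thesis using nonneg by (auto intro: sum_nonneg)
  next
    case False
    then show ?thesis using above[rule_format, of k] \<open>k \<le> n\<close> by (simp add: algebra_simps)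
  qed
  moreover have "t < (1 + e) * (k + 1)"
    using k \<rho> by (simp add: e field_simps)
  ultimately show ?thesis
    using first e by (simp add: workload_def algebra_simps)
qed

lemma hitting_time_gt:
  assumes "0 < \<rho>" "\<rho> * T < a" "\<And>t. 0 \<le> t \<Longrightarrow> \<rho> * t < a \<Longrightarrow> workload Bs N \<rho> t \<omega> \<noteq> 0"
  shows "ereal T < hitting_time Bs N \<rho> \<omega>"
proof -
  have "ereal T < ereal (a / \<rho>)" using assms by (simp add: field_simps)
  also have "\<dots> \<le> hitting_time Bs N \<rho> \<omega>"
    unfolding hitting_time_def
  proof (rule Inf_greatest)
    fix x assume "x \<in> ereal ` {t. 0 \<le> t \<and> workload Bs N \<rho> t \<omega> = 0}"
    then obtain t where t: "x = ereal t" "0 \<le> t" "workload Bs N \<rho> t \<omega> = 0" by auto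
    then have "\<not> \<rho> * t < a" using assms(3) by blast
    then show "ereal (a / \<rho>) \<le> x" using assms(1) by (simp add: t field_simps)
  qed
  finally show ?thesis .
qed

lemma batch_walk_eq:
  "\<omega> \<in> space M \<Longrightarrow> (\<Sum>j<k. batch_sum (Suc j) \<omega> - 1) = (\<Sum>i=1..N (real k) \<omega>. Bs i \<omega>) - k"
proof (induction k)
  case 0
  then show ?case by (simp add: N_0)
next
  case (Suc k)
  have "N (real k) \<omega> \<le> N (real (Suc k)) \<omega>" using Suc by (intro N_mono) auto
  then have "(\<Sum>i=1..N (real (Suc k)) \<omega>. Bs i \<omega>)
      = (\<Sum>i=1..N (real k) \<omega>. Bs i \<omega>) + batch_sum (Suc k) \<omega>"
    unfolding batch_sum_def batch.simps
    by (subst sum.union_disjoint[symmetric]) (auto intro!: sum.cong)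
  then show ?case using Suc by simp
qed

text \<open>The initial workload is independent of the walk, so the requirement \<open>B\<^sub>0 > 2\<close> only costs a constant
  factor in \<open>prob_above_line_ge\<close>.\<close>
lemma prob_workload_walk_ge:
  assumes Y: "0 < Y" and big: "0 < prob {\<omega>\<in>space M. 2 < Bs 0 \<omega>}"
  shows "\<exists>c>0. \<exists>e0>0. \<forall>e. 0 < e \<and> e \<le> e0 \<longrightarrow>
    c * e \<le> prob {\<omega>\<in>space M. 2 < Bs 0 \<omega> \<and>
      (\<forall>k\<in>{1..nat \<lfloor>Y / e\<^sup>2\<rfloor>}. e * real k < (\<Sum>i=1..N (real k) \<omega>. Bs i \<omega>) - k)}"
proof -
  obtain \<sigma> where "centered_walk M (\<lambda>k \<omega>. batch_sum (Suc k) \<omega> - 1) \<sigma>"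
    using centered_batch_walk by blast
  then interpret w: centered_walk M "\<lambda>k \<omega>. batch_sum (Suc k) \<omega> - 1" \<sigma> .
  interpret b: indep_sequence M batch_sum
    by unfold_locales (rule indep_batch_sums)
  obtain c e0 where c: "0 < c" "0 < e0"
    and le: "\<And>e. 0 < e \<Longrightarrow> e \<le> e0 \<Longrightarrow> c * e \<le> prob {\<omega>\<in>space M. w.alive e (nat \<lfloor>Y / e\<^sup>2\<rfloor>) \<omega>}"
    using w.prob_above_line_ge[OF Y] by blast
  let ?p = "prob {\<omega>\<in>space M. 2 < Bs 0 \<omega>}"
  have "?p * c * e \<le> prob {\<omega>\<in>space M. 2 < Bs 0 \<omega> \<and>
      (\<forall>k\<in>{1..nat \<lfloor>Y / e\<^sup>2\<rfloor>}. e * real k < (\<Sum>i=1..N (real k) \<omega>. Bs i \<omega>) - k)}"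
    if e: "0 < e" "e \<le> e0" for e
  proof -
    let ?n = "nat \<lfloor>Y / e\<^sup>2\<rfloor>"
    have [measurable]: "batch_sum 0 \<in> borel_measurable (b.info {0})"
      by (rule b.X_info) simp
    have [measurable]: "w.W k \<in> borel_measurable (b.info {1..})" for k
      unfolding w.W_def[abs_def] by (intro borel_measurable_sum borel_measurable_diff b.X_info) auto
    have f: "Measurable.pred (b.info {0}) (\<lambda>\<omega>. 2 < batch_sum 0 \<omega>)"
      by measurable
    have a: "Measurable.pred (b.info {1..}) (w.alive e ?n)"
      unfolding w.alive_def[abs_def] by measurable
    have "?p * c * e \<le> ?p * prob {\<omega>\<in>space M. w.alive e ?n \<omega>}"
      using mult_left_mono[OF le[OF e], of ?p] by (simp add: mult.assoc)
    also have "\<dots> = prob {\<omega>\<in>space M. 2 < batch_sum 0 \<omega> \<and> w.alive e ?n \<omega>}"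
      using b.prob_conj_info[OF _ f a] by (simp add: batch_sum_def[of 0])
    also have "{\<omega>\<in>space M. 2 < batch_sum 0 \<omega> \<and> w.alive e ?n \<omega>}
      = {\<omega>\<in>space M. 2 < Bs 0 \<omega> \<and>
      (\<forall>k\<in>{1..?n}. e * real k < (\<Sum>i=1..N (real k) \<omega>. Bs i \<omega>) - k)}"
      by (auto simp: w.alive_def w.W_def batch_walk_eq batch_sum_def[of 0])
    finally show ?thesis .
  qed
  then show ?thesis
    using c big by (intro exI[of _ "?p * c"] conjI exI[of _ e0]) auto
qed

text \<open>The values of the process are known to be measurable at fixed times only. By right-continuity its value at a random time is the
  limit of its values at random times strictly to the right that take values in a countable grid.\<close>
lemma measurable_N_at:
  assumes [measurable]: "U \<in> borel_measurable M" and U: "\<And>\<omega>. \<omega> \<in> space M \<Longrightarrow> 0 \<le> U \<omega>"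
  shows "(\<lambda>\<omega>. real (N (U \<omega>) \<omega>)) \<in> borel_measurable M"
proof (rule borel_measurable_LIMSEQ_real)
  define s where "s j \<omega> = real (nat \<lfloor>real (Suc j) * U \<omega>\<rfloor> + 1) / real (Suc j)" for j \<omega>
  show "(\<lambda>\<omega>. real (N (s j \<omega>) \<omega>)) \<in> borel_measurable M" for j
    unfolding s_def
    by (rule measurable_compose_countable[where f="\<lambda>k \<omega>. real (N (real (k + 1) / real (Suc j)) \<omega>)"])
       (auto intro!: measurable_compose[OF N_measurable] simp del: of_nat_Suc)
  fix \<omega> assume \<omega>: "\<omega> \<in> space M"
  have s: "U \<omega> < s j \<omega>" "s j \<omega> \<le> U \<omega> + inverse (real (Suc j))" for j
  proof -
    have "0 \<le> real (Suc j) * U \<omega>" using U[OF \<omega>] by simp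
    then have "real (Suc j) * U \<omega> < real (nat \<lfloor>real (Suc j) * U \<omega>\<rfloor> + 1)"
      "real (nat \<lfloor>real (Suc j) * U \<omega>\<rfloor> + 1) \<le> real (Suc j) * U \<omega> + 1" by linarith+
    then show "U \<omega> < s j \<omega>" "s j \<omega> \<le> U \<omega> + inverse (real (Suc j))"
      unfolding s_def by (simp_all add: field_simps del: of_nat_Suc of_nat_add)
  qed
  have "(\<lambda>j. s j \<omega>) \<longlonglongrightarrow> U \<omega>"
  proof (rule tendsto_sandwich[where f = "\<lambda>_. U \<omega>" and h = "\<lambda>j. U \<omega> + inverse (real (Suc j))"])
    show "(\<lambda>j. U \<omega> + inverse (real (Suc j))) \<longlonglongrightarrow> U \<omega>"
      using tendsto_add[OF tendsto_const LIMSEQ_inverse_real_of_nat] by simp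
  qed (use s in \<open>auto intro!: always_eventually intro: less_imp_le simp del: of_nat_Suc\<close>)
  then have "filterlim (\<lambda>j. s j \<omega>) (at_right (U \<omega>)) sequentially"
    by (simp add: filterlim_at s(1) less_imp_neq[OF s(1), THEN not_sym])
  moreover have "((\<lambda>t. real (N t \<omega>)) \<longlongrightarrow> real (N (U \<omega>) \<omega>)) (at_right (U \<omega>))"
    using N_right_cont[OF \<omega> U[OF \<omega>]] by (simp add: continuous_within)
  ultimately show "(\<lambda>j. real (N (s j \<omega>) \<omega>)) \<longlonglongrightarrow> real (N (U \<omega>) \<omega>)"
    by (rule filterlim_compose[rotated])
qed

text \<open>If the workload vanishes after \<open>m\<close> arrivals, it does so exactly at the time \<open>V m\<close> equal to the total
  work brought in so far. This replaces the uncountably many candidate times by countably many random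
  times. The maximum with \<open>0\<close> keeps the argument of the process in its time range.\<close>
lemma hit_before_iff:
  assumes "0 < \<rho>"
  defines "V m \<omega> \<equiv> Bs 0 \<omega> + (\<Sum>i=1..m. Bs i \<omega>)"
  shows "(\<exists>t. 0 \<le> t \<and> t \<le> q \<and> workload Bs N \<rho> t \<omega> = 0)
    \<longleftrightarrow> (\<exists>m. 0 \<le> V m \<omega> \<and> V m \<omega> \<le> q \<and> real (N (\<rho> * max 0 (V m \<omega>)) \<omega>) = real m)"
  (is "?L \<longleftrightarrow> ?R")
proof
  assume ?L
  then obtain t where t: "0 \<le> t" "t \<le> q" "workload Bs N \<rho> t \<omega> = 0" by blast
  then have "V (N (\<rho> * t) \<omega>) \<omega> = t" by (simp add: workload_def V_def)
  then show ?R using t by (intro exI[of _ "N (\<rho> * t) \<omega>"]) simp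
next
  assume ?R
  then obtain m where m: "0 \<le> V m \<omega>" "V m \<omega> \<le> q" "N (\<rho> * V m \<omega>) \<omega> = m" by auto
  then show ?L by (intro exI[of _ "V m \<omega>"]) (simp add: workload_def V_def)
qed

lemma hitting_time_gt_iff:
  "ereal T < hitting_time Bs N \<rho> \<omega> \<longleftrightarrow>
    (\<exists>q::rat. T < of_rat q \<and> \<not> (\<exists>t. 0 \<le> t \<and> t \<le> of_rat q \<and> workload Bs N \<rho> t \<omega> = 0))"
proof
  assume *: "ereal T < hitting_time Bs N \<rho> \<omega>"
  obtain q :: rat where q: "ereal T < ereal (of_rat q)" "ereal (of_rat q) < hitting_time Bs N \<rho> \<omega>"
    using ereal_dense3[OF *] by auto
  have "\<not> (0 \<le> t \<and> t \<le> of_rat q \<and> workload Bs N \<rho> t \<omega> = 0)" for t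
  proof
    assume t: "0 \<le> t \<and> t \<le> of_rat q \<and> workload Bs N \<rho> t \<omega> = 0"
    then have "hitting_time Bs N \<rho> \<omega> \<le> ereal t"
      unfolding hitting_time_def by (intro Inf_lower) auto
    also have "\<dots> \<le> ereal (of_rat q)" using t by simp
    finally show False using q(2) by simp
  qed
  then show "\<exists>q::rat. T < of_rat q \<and> \<not> (\<exists>t. 0 \<le> t \<and> t \<le> of_rat q \<and> workload Bs N \<rho> t \<omega> = 0)"
    using q(1) by auto
next
  assume "\<exists>q::rat. T < of_rat q \<and> \<not> (\<exists>t. 0 \<le> t \<and> t \<le> of_rat q \<and> workload Bs N \<rho> t \<omega> = 0)"
  then obtain q :: rat where q: "T < of_rat q"
    "\<And>t. 0 \<le> t \<Longrightarrow> workload Bs N \<rho> t \<omega> = 0 \<Longrightarrow> of_rat q < t" by (metis not_le)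
  have "ereal T < ereal (of_rat q)" using q by simp
  also have "\<dots> \<le> hitting_time Bs N \<rho> \<omega>"
    unfolding hitting_time_def using q(2) by (intro Inf_greatest) (auto intro: less_imp_le)
  finally show "ereal T < hitting_time Bs N \<rho> \<omega>" .
qed

text \<open>Measurability is needed for the monotonicity of the measure in the lower bound below, as a
  nonmeasurable event would count as having measure \<open>0\<close>.\<close>
lemma sets_hitting_time_gt:
  assumes \<rho>: "0 < \<rho>"
  shows "{\<omega>\<in>space M. ereal T < hitting_time Bs N \<rho> \<omega>} \<in> sets M"
proof -
  have [measurable]: "(\<lambda>\<omega>. real (N (\<rho> * max 0 (Bs 0 \<omega> + (\<Sum>i=1..m. Bs i \<omega>))) \<omega>)) \<in> borel_measurable M" for m
    by (rule measurable_N_at) (use \<rho> in auto)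
  show ?thesis
    unfolding hitting_time_gt_iff hit_before_iff[OF \<rho>] by measurable
qed

lemma prob_hitting_time_ge:
  assumes y: "0 < y" and big: "0 < prob {\<omega>\<in>space M. 2 < Bs 0 \<omega>}"
  shows "\<exists>c>0. eventually (\<lambda>\<rho>. c * (1 - \<rho>)
    \<le> prob {\<omega>\<in>space M. ereal (y / (1 - \<rho>)\<^sup>2) < hitting_time Bs N \<rho> \<omega>}) (at_left 1)"
proof -
  obtain c e0 where c: "0 < c" "0 < e0" and le: "\<And>e. 0 < e \<Longrightarrow> e \<le> e0 \<Longrightarrow>
    c * e \<le> prob {\<omega>\<in>space M. 2 < Bs 0 \<omega> \<and>
      (\<forall>k\<in>{1..nat \<lfloor>2 * y / e\<^sup>2\<rfloor>}. e * real k < (\<Sum>i=1..N (real k) \<omega>. Bs i \<omega>) - k)}"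
    using prob_workload_walk_ge[of "2 * y", OF _ big] y by auto
  (* \<rho> > 1 / 2 ensures e \<le> 1 and \<rho> y / (1 - \<rho>)\<^sup>2 \<le> 2 y / e\<^sup>2, which is why Y = 2 y was chosen above *)
  define \<rho>0 where "\<rho>0 = max (1 / 2) (1 / (1 + e0))"
  have "\<rho>0 < 1" using c by (simp add: \<rho>0_def field_simps)
  then have "eventually (\<lambda>\<rho>. \<rho> \<in> {\<rho>0<..<1}) (at_left 1)"
    by (rule eventually_at_left_real)
  then have "eventually (\<lambda>\<rho>. c * (1 - \<rho>)
    \<le> prob {\<omega>\<in>space M. ereal (y / (1 - \<rho>)\<^sup>2) < hitting_time Bs N \<rho> \<omega>}) (at_left 1)"
  proof eventually_elim
    case (elim \<rho>)
    then have \<rho>: "1 / 2 < \<rho>" "1 / (1 + e0) < \<rho>" "\<rho> < 1" by (auto simp: \<rho>0_def)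
    define e where "e = 1 / \<rho> - 1"
    have "1 / \<rho> < 1 + e0" "1 / \<rho> < 2" using \<rho> c by (simp_all add: field_simps)
    then have e: "0 < e" "e \<le> e0" "e \<le> 1" and e_eq: "e = (1 - \<rho>) / \<rho>"
      using \<rho> by (auto simp: e_def field_simps)
    have le_e: "1 - \<rho> \<le> e"
      using mult_left_le[of \<rho> "1 - \<rho>"] \<rho> by (simp add: e_eq pos_le_divide_eq)
    define n where "n = nat \<lfloor>2 * y / e\<^sup>2\<rfloor>"
    have horizon: "\<rho> * (y / (1 - \<rho>)\<^sup>2) < real n + 1"
    proof -
      have "\<rho> * (y / (1 - \<rho>)\<^sup>2) \<le> 2 * \<rho>\<^sup>2 * (y / (1 - \<rho>)\<^sup>2)"
        using \<rho> y by (intro mult_right_mono) (auto simp: power2_eq_square)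
      also have "\<dots> = 2 * y / e\<^sup>2" by (simp add: e_eq power_divide)
      also have "\<dots> < real n + 1" unfolding n_def by linarith
      finally show ?thesis .
    qed
    let ?P = "\<lambda>\<omega>. 2 < Bs 0 \<omega> \<and> (\<forall>k\<in>{1..n}. e * real k < (\<Sum>i=1..N (real k) \<omega>. Bs i \<omega>) - k)"
    have "c * (1 - \<rho>) \<le> c * e" using le_e c by (intro mult_left_mono) auto
    also have "\<dots> \<le> prob {\<omega>\<in>space M. ?P \<omega>}" using le[OF e(1,2)] by (simp add: n_def)
    also have "\<dots> \<le> prob {\<omega>\<in>space M. ereal (y / (1 - \<rho>)\<^sup>2) < hitting_time Bs N \<rho> \<omega>}"
    proof (rule finite_measure_mono_AE)
      show "{\<omega>\<in>space M. ereal (y / (1 - \<rho>)\<^sup>2) < hitting_time Bs N \<rho> \<omega>} \<in> sets M"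
        by (rule sets_hitting_time_gt) (use \<rho> in simp)
      show "AE \<omega> in M. \<omega> \<in> {\<omega>\<in>space M. ?P \<omega>} \<longrightarrow>
          \<omega> \<in> {\<omega>\<in>space M. ereal (y / (1 - \<rho>)\<^sup>2) < hitting_time Bs N \<rho> \<omega>}"
        using all_nonneg
      proof eventually_elim
        case (elim \<omega>)
        have "ereal (y / (1 - \<rho>)\<^sup>2) < hitting_time Bs N \<rho> \<omega>" if "\<omega> \<in> space M" "?P \<omega>"
        proof (rule hitting_time_gt[OF _ horizon])
          fix t assume "0 \<le> t" "\<rho> * t < real n + 1"
          then have "0 < workload Bs N \<rho> t \<omega>"
            using workload_pos[of \<omega> \<rho> e n t] that elim e \<rho> e_def by auto
          then show "workload Bs N \<rho> t \<omega> \<noteq> 0" by simp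
        qed (use \<rho> in simp)
        then show ?case by blast
      qed
    qed
    finally show ?case .
  qed
  then show ?thesis using c by blast
qed

end

section \<open>Divergence of the ratio\<close>

lemma slowly_varying_eventually_nonzero:
  assumes "slowly_varying L"
  shows "eventually (\<lambda>x. L x \<noteq> 0) at_top"
proof -
  have "((\<lambda>x. L (2 * x) / L x) \<longlongrightarrow> 1) at_top"
    using assms by (simp add: slowly_varying_def)
  then have "eventually (\<lambda>x. 0 < L (2 * x) / L x) at_top"
    by (rule order_tendstoD) simp
  then show ?thesis by eventually_elim auto
qed

theorem lemma3p8:
  fixes M :: "'a measure"
    and B :: "'a \<Rightarrow> real"
    and Bs :: "nat \<Rightarrow> 'a \<Rightarrow> real"
    and N :: "real \<Rightarrow> 'a \<Rightarrow> nat"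
    and L :: "real \<Rightarrow> real"
    and \<alpha> y :: real
  assumes "prob_space M"
    and "B \<in> borel_measurable M"
    and "prob_space.indep_vars M (\<lambda>_. borel) Bs UNIV"
    and "\<And>i. distr M borel (Bs i) = distr M borel B"
    and "AE \<omega> in M. 0 \<le> B \<omega>"
    and "measure M {\<omega>\<in>space M. B \<omega> \<le> 0} = 0"
    and "integrable M B"
    and "0 < prob_space.expectation M B"
    and "integrable M (\<lambda>\<omega>. (B \<omega>)\<^sup>2)"
    and "poisson_process M (1 / prob_space.expectation M B) N"
    and "process_indep_of_seq M N Bs"
    and "slowly_varying L"
    and "\<alpha> > 2"
    and "\<And>x. x > 0 \<Longrightarrow> measure M {\<omega>\<in>space M. B \<omega> > x} = L x * x powr (- \<alpha>)"
    and "y > 0"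
  shows "filterlim
    (\<lambda>\<rho>. let ystar = y / (1 - \<rho>)\<^sup>2 in
       measure M {\<omega>\<in>space M. hitting_time Bs N \<rho> \<omega> > ereal ystar}
         / (\<rho> / (1 - \<rho>) * measure M {\<omega>\<in>space M. B \<omega> > (1 - \<rho>) * ystar}))
    at_top (at_left 1)"
proof -
  interpret prob_space M by fact
  note [measurable] = assms(2)
  define q where "q x = prob {\<omega>\<in>space M. x < B \<omega>}" for x
  have Bs_meas [measurable]: "Bs i \<in> borel_measurable M" for i
    using assms(3) by (auto simp: indep_vars_def)
  have law: "f \<in> borel_measurable borel \<Longrightarrow> expectation (\<lambda>\<omega>. f (Bs i \<omega>) :: real) = expectation (\<lambda>\<omega>. f (B \<omega>))"
    "f \<in> borel_measurable borel \<Longrightarrow> integrable M (\<lambda>\<omega>. f (Bs i \<omega>)) \<longleftrightarrow> integrable M (\<lambda>\<omega>. f (B \<omega>))" for f i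
    using integral_distr[of "Bs i" M borel f] integral_distr[of B M borel f] assms(4)[of i]
      integrable_distr_eq[of "Bs i" M borel f] integrable_distr_eq[of B M borel f] by auto
  interpret compound_poisson M Bs "1 / expectation B" N
  proof
    show "distr M borel (Bs i) = distr M borel (Bs 0)" for i using assms(4) by simp
    have "AE x in distr M borel B. 0 \<le> x" using assms(5) by (simp add: AE_distr_iff)
    then have "AE x in distr M borel (Bs 0). 0 \<le> x" unfolding assms(4) .
    then show "AE \<omega> in M. 0 \<le> Bs 0 \<omega>" by (simp add: AE_distr_iff)
    show "integrable M (Bs 0)" using law(2)[of "\<lambda>x. x"] assms(7) by simp
    show "integrable M (\<lambda>\<omega>. (Bs 0 \<omega>)\<^sup>2)" using law(2)[of "\<lambda>x. x\<^sup>2"] assms(9) by simp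
    show "1 / expectation B * expectation (Bs 0) = 1" using law(1)[of "\<lambda>x. x"] assms(8) by simp
  qed (use assms in auto)
  have q_mono: "q x \<le> q x'" if "x' \<le> x" for x x'
    unfolding q_def using that by (intro finite_measure_mono) auto
  have q_pos: "0 < q x" for x
  proof -
    obtain x' where x': "max 1 x \<le> x'" "L x' \<noteq> 0"
      using eventually_happens[OF eventually_conj[OF eventually_ge_at_top[of "max 1 x"]
        slowly_varying_eventually_nonzero[OF assms(12)]]] by auto
    have "q x' = L x' * x' powr (- \<alpha>)"
      using assms(14)[of x'] x' by (simp add: q_def)
    then have "q x' \<noteq> 0" using x' by simp
    moreover have "0 \<le> q x'" by (simp add: q_def)
    ultimately show ?thesis using q_mono[of x x'] x' by linarith
  qed
  have "prob {\<omega>\<in>space M. 2 < Bs 0 \<omega>} = q 2"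
  proof -
    have "measure (distr M borel (Bs 0)) {2<..} = measure (distr M borel B) {2<..}"
      unfolding assms(4) ..
    then show ?thesis
      by (simp add: measure_distr q_def vimage_def Int_def conj_commute)
  qed
  then obtain c where c: "0 < c" and ge: "eventually (\<lambda>\<rho>. c * (1 - \<rho>)
      \<le> prob {\<omega>\<in>space M. ereal (y / (1 - \<rho>)\<^sup>2) < hitting_time Bs N \<rho> \<omega>}) (at_left 1)"
    using prob_hitting_time_ge[OF assms(15)] q_pos by auto
  have "((\<lambda>x. x\<^sup>2 * q x) \<longlongrightarrow> 0) at_top"
    unfolding q_def by (rule second_moment_tail) (use assms in auto)
  moreover have "eventually (\<lambda>x. x\<^sup>2 * q x \<in> {0<..} \<and> x\<^sup>2 * q x \<noteq> 0) at_top"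
    using eventually_gt_at_top[of 0]
  proof eventually_elim
    case (elim x)
    then show ?case using q_pos[of x] by auto
  qed
  ultimately have "filterlim (\<lambda>x. x\<^sup>2 * q x) (at_right 0) at_top"
    unfolding filterlim_at by simp
  then have lim: "filterlim (\<lambda>x. c * y\<^sup>2 * inverse (x\<^sup>2 * q x)) at_top at_top"
    using c assms(15)
    by (intro filterlim_tendsto_pos_mult_at_top[OF tendsto_const]
        filterlim_compose[OF filterlim_inverse_at_top_right]) auto
  have x_lim: "filterlim (\<lambda>\<rho>. y / (1 - \<rho>)) at_top (at_left 1)"
    using assms(15) by real_asymp
  show ?thesis
    unfolding Let_def
  proof (rule filterlim_at_top_mono[OF filterlim_compose[OF lim x_lim]])
    have "eventually (\<lambda>\<rho>. \<rho> \<in> {0<..<1}) (at_left (1::real))"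
      by (rule eventually_at_left_real) simp
    then show "eventually (\<lambda>\<rho>. c * y\<^sup>2 * inverse ((y / (1 - \<rho>))\<^sup>2 * q (y / (1 - \<rho>)))
      \<le> prob {\<omega>\<in>space M. ereal (y / (1 - \<rho>)\<^sup>2) < hitting_time Bs N \<rho> \<omega>}
         / (\<rho> / (1 - \<rho>) * prob {\<omega>\<in>space M. (1 - \<rho>) * (y / (1 - \<rho>)\<^sup>2) < B \<omega>})) (at_left 1)"
      using ge
    proof eventually_elim
      case (elim \<rho>)
      let ?x = "y / (1 - \<rho>)"
      have \<rho>: "0 < \<rho>" "\<rho> < 1" using elim by auto
      have x: "(1 - \<rho>) * (y / (1 - \<rho>)\<^sup>2) = ?x" using \<rho> by (simp add: power2_eq_square)
      have "c * y\<^sup>2 * inverse (?x\<^sup>2 * q ?x) = c * (1 - \<rho>) / (1 / (1 - \<rho>) * q ?x)"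
        using \<rho> assms(15) q_pos[of ?x] by (simp add: field_simps power2_eq_square)
      also have "\<dots> \<le> prob {\<omega>\<in>space M. ereal (y / (1 - \<rho>)\<^sup>2) < hitting_time Bs N \<rho> \<omega>}
          / (\<rho> / (1 - \<rho>) * q ?x)"
        using \<rho> c q_pos[of ?x] elim
        by (intro frac_le mult_right_mono divide_right_mono mult_pos_pos) auto
      finally show ?case unfolding x q_def .
    qed
  qed
qed

end
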